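(* (i) Let $(s_1^{(m)},s_2^{(m)})$ $(m=1,2,\ldots)$ be a sequence of points on a zero-divisor of $\zeta_2(s_1,s_2)$. If $\sigma_1^{(m)}=\Re s_1^{(m)}$ tends to $+\infty$ and $|s_2^{(m)}|$ remains bounded, with $s_2^{(m)}$ not close to $1$ (i.e. $|s_2^{(m)}-1|$ is bounded below by a positive constant), as $m\to\infty$, then $s_2^{(m)}$ tends to a solution of $\zeta(s_2)=1$. (ii) Conversely, for any solution $\rho_2$ of $\zeta(\rho_2)=1$ and any $\varepsilon>0$, we can find a zero $(s_1,s_2)$ of $\zeta_2(s_1,s_2)$ such that $|s_2-\rho_2|<\varepsilon$.
   Context: $\zeta$ is the Riemann zeta-function. $\zeta_2(s_1,s_2)$ is the Euler double zeta-function $$\zeta_2(s_1,s_2)=\sum_{n_1=1}^{\infty}\sum_{n_2=1}^{\infty}\frac{1}{n_1^{s_1}(n_1+n_2)^{s_2}},$$ where $s_1,s_2$ are complex variables; the series is absolutely convergent for $\Re s_1+\Re s_2>2$, $\Re s_2>1$, and $\zeta_2$ denotes also its meromorphic continuation to $\mathbb{C}^2$. The zeros of $\zeta_2$, as a function of two variables, are not isolated points but form analytic sets in $\mathbb{C}^2$; such a set is called a zero-set (zero-divisor) of $\zeta_2$.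
   Formalization: In (i), "tends to a solution" fails if the sequence alternates between branches near different solutions; proved instead: the distance from s_2^(m) to suitable solutions rho_m tends to 0, with convergence to one solution if the points eventually lie in connected pieces of the zero-set. *)

theory Defs
  imports "HOL-Complex_Analysis.Complex_Analysis"
begin

(* The library's "nicely meromorphic" functions take the value 0 at their poles and are analytic
   everywhere else, so the continuation is unique as a total function.
   In particular riemann_zeta 1 = 0. *)
definition riemann_zeta :: "complex \<Rightarrow> complex" where
  "riemann_zeta = (THE f. f nicely_meromorphic_on UNIV \<and>
     (\<forall>s. Re s > 1 \<longrightarrow> f s = (\<Sum>n. 1 / of_nat (Suc n) powr s)))"

(* Complex differentiability in two variables: the Frechet derivative exists at every point of U
   and is complex linear.  Intended for open U. *)
definition holomorphic2_on :: "(complex \<times> complex \<Rightarrow> complex) \<Rightarrow> (complex \<times> complex) set \<Rightarrow> bool" where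
  "holomorphic2_on f U \<longleftrightarrow>
     (\<forall>p\<in>U. \<exists>a b. (f has_derivative (\<lambda>(h1, h2). a * h1 + b * h2)) (at p))"

definition holomorphic2_at :: "(complex \<times> complex \<Rightarrow> complex) \<Rightarrow> complex \<times> complex \<Rightarrow> bool" where
  "holomorphic2_at f p \<longleftrightarrow> (\<exists>U. open U \<and> p \<in> U \<and> holomorphic2_on f U)"

(* Locally f is a quotient g / h with h not vanishing identically on any nonempty open subset.
   The values of f on the nowhere dense set where h = 0 are left unconstrained here. *)
definition meromorphic2 :: "(complex \<times> complex \<Rightarrow> complex) \<Rightarrow> bool" where
  "meromorphic2 f \<longleftrightarrow>
     (\<forall>p. \<exists>U g h. open U \<and> p \<in> U \<and> holomorphic2_on g U \<and> holomorphic2_on h U \<and>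
        U \<subseteq> closure {z \<in> U. h z \<noteq> 0} \<and> (\<forall>z\<in>U. h z \<noteq> 0 \<longrightarrow> f z = g z / h z))"

(* Two-variable analogue of the library's nicely_meromorphic_on: every singularity that can be
   removed has been removed, and the value at the remaining singular points (poles and points of
   indeterminacy) is 0 by convention. *)
definition nicely_meromorphic2 :: "(complex \<times> complex \<Rightarrow> complex) \<Rightarrow> bool" where
  "nicely_meromorphic2 f \<longleftrightarrow> meromorphic2 f \<and>
     (\<forall>p. if \<exists>U g. open U \<and> p \<in> U \<and> holomorphic2_on g U \<and> U \<subseteq> closure {z \<in> U. f z = g z}
          then holomorphic2_at f p else f p = 0)"

definition euler_double_zeta :: "complex \<times> complex \<Rightarrow> complex" where
  "euler_double_zeta = (THE f. nicely_meromorphic2 f \<and>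
     (\<forall>s1 s2. Re s1 + Re s2 > 2 \<and> Re s2 > 1 \<longrightarrow>
        f (s1, s2) = (\<Sum>\<^sub>\<infinity>(n1, n2)\<in>{1::nat..} \<times> {1::nat..}.
                        1 / (of_nat n1 powr s1 * of_nat (n1 + n2) powr s2))))"

(* Regularity is required because of the value 0 assigned to singular points. *)
definition zero_set2 :: "(complex \<times> complex \<Rightarrow> complex) \<Rightarrow> (complex \<times> complex) set" where
  "zero_set2 f = {p. holomorphic2_at f p \<and> f p = 0}"

end

(* The continuation of zeta_2 to C^2 comes from the translation formula: expanding
   (m-1)^(1-s) - m^(1-s) in powers of 1/m and summing over m > n >= 1 expresses
   (s2 - 1) zeta_2(s1, s2) through zeta(s1 + s2 - 1), the values zeta_2(s1, s2 + k) with k >= 1,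
   and a remainder that is holomorphic in a region growing with the order of the expansion.
   For Re s1 large, zeta_2(s1, s2) is also the sum over n of
   n^(-s1) (zeta(s2) - sum_{m<=n} m^(-s2)), so it tends to zeta(s2) - 1 exponentially fast and
   uniformly for s2 in compact sets away from 1.  Part (i) then follows by compactness, the
   solutions of zeta = 1 being isolated, and part (ii) from Hurwitz's theorem. *)
theory Submission
  imports Defs
begin

section \<open>Holomorphic functions of two variables\<close>

text \<open>Both zeta functions are defined with \<open>THE\<close>, so existence of a continuation
  is not enough: it must be unique as a total function, including its values on the singular set. In
  two variables this set is not discrete and contains points of indeterminacy, so the proof never
  handles singular values directly. It builds an entire numerator, namely zeta_2 multiplied by (s2 -
  1) / \<Gamma>(s1 + s2 - 2), and lets a general lemma turn the quotient into the normalised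
  meromorphic function.

  The limit function is treated in the same spirit. The comparison uses (s2 - 1) (zeta(s2) - 1),
  which is entire with value 1 at s2 = 1. This value is the residue of zeta, so it is tracked
  through the continuation; it shows that the function is not identically zero, hence that its zeros
  are isolated, and it excludes a constant limit in Hurwitz's theorem.

  In part (i) a sequence of zeros can keep jumping between neighbourhoods of different solutions of
  zeta = 1. Compactness alone therefore yields approach to the solution set; convergence to one
  solution comes from staying on a connected piece of the zero-set.\<close>

lemma holomorphic2_on_altdef:
  "holomorphic2_on f U \<longleftrightarrow>
     (\<forall>p\<in>U. \<exists>a b. (f has_derivative (\<lambda>h. a * fst h + b * snd h)) (at p))"
  by (simp add: holomorphic2_on_def case_prod_unfold)

lemma holomorphic2_on_subset: "holomorphic2_on f U \<Longrightarrow> V \<subseteq> U \<Longrightarrow> holomorphic2_on f V"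
  by (auto simp: holomorphic2_on_def)

lemma holomorphic2_on_const: "holomorphic2_on (\<lambda>p. c) U"
  unfolding holomorphic2_on_altdef
  by (intro ballI exI[of _ 0]) simp

lemma holomorphic2_on_fst: "holomorphic2_on fst U"
  unfolding holomorphic2_on_altdef
  by (intro ballI exI[of _ 1] exI[of _ 0]) (auto intro!: derivative_eq_intros)

lemma holomorphic2_on_snd: "holomorphic2_on snd U"
  unfolding holomorphic2_on_altdef
  by (intro ballI exI[of _ 0] exI[of _ 1]) (auto intro!: derivative_eq_intros)

text \<open>The chain rule from which closure under sums and products follows, by composing with the
  addition and multiplication maps.\<close>

lemma holomorphic2_on_compose2:
  assumes F: "holomorphic2_on F U" and a: "holomorphic2_on a V" and b: "holomorphic2_on b V"
    and sub: "\<And>p. p \<in> V \<Longrightarrow> (a p, b p) \<in> U"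
  shows "holomorphic2_on (\<lambda>p. F (a p, b p)) V"
  unfolding holomorphic2_on_altdef
proof
  fix p assume p: "p \<in> V"
  obtain a1 a2 where a: "(a has_derivative (\<lambda>h. a1 * fst h + a2 * snd h)) (at p)"
    using a p unfolding holomorphic2_on_altdef by blast
  obtain b1 b2 where b: "(b has_derivative (\<lambda>h. b1 * fst h + b2 * snd h)) (at p)"
    using b p unfolding holomorphic2_on_altdef by blast
  obtain c1 c2 where F: "(F has_derivative (\<lambda>h. c1 * fst h + c2 * snd h)) (at (a p, b p))"
    using F sub[OF p] unfolding holomorphic2_on_altdef by blast
  have "((\<lambda>p. F (a p, b p)) has_derivative
          (\<lambda>h. c1 * (a1 * fst h + a2 * snd h) + c2 * (b1 * fst h + b2 * snd h))) (at p)"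
    using has_derivative_compose[OF has_derivative_Pair[OF a b] F] by simp
  also have "(\<lambda>h. c1 * (a1 * fst h + a2 * snd h) + c2 * (b1 * fst h + b2 * snd h)) =
             (\<lambda>h. (c1*a1 + c2*b1) * fst h + (c1*a2 + c2*b2) * snd h)"
    by (simp add: algebra_simps)
  finally show "\<exists>a' b'. ((\<lambda>p. F (a p, b p)) has_derivative (\<lambda>h. a' * fst h + b' * snd h)) (at p)"
    by blast
qed

lemma holomorphic2_on_compose1:
  assumes f: "f holomorphic_on S" "open S" and g: "holomorphic2_on g U"
    and sub: "\<And>p. p \<in> U \<Longrightarrow> g p \<in> S"
  shows "holomorphic2_on (\<lambda>p. f (g p)) U"
  unfolding holomorphic2_on_altdef
proof
  fix p assume p: "p \<in> U"
  obtain a b where g: "(g has_derivative (\<lambda>h. a * fst h + b * snd h)) (at p)"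
    using g p unfolding holomorphic2_on_altdef by blast
  obtain d where "(f has_field_derivative d) (at (g p))"
    using holomorphic_on_imp_differentiable_at[OF f sub[OF p]]
    by (auto simp: field_differentiable_def)
  hence "(f has_derivative (*) d) (at (g p))"
    by (simp add: has_field_derivative_def)
  from has_derivative_compose[OF g this]
  have "((\<lambda>p. f (g p)) has_derivative (\<lambda>h. (d * a) * fst h + (d * b) * snd h)) (at p)"
    by (simp add: algebra_simps)
  thus "\<exists>a b. ((\<lambda>p. f (g p)) has_derivative (\<lambda>h. a * fst h + b * snd h)) (at p)"
    by blast
qed

text \<open>The bridge to one-variable theory: pulling back along a holomorphic curve makes Cauchy's
  inequality, analytic continuation and Hurwitz's theorem available.\<close>

lemma holomorphic2_on_imp_holomorphic_on:
  assumes F: "holomorphic2_on F U" and a: "a holomorphic_on S" and b: "b holomorphic_on S"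
    and "open S" and sub: "\<And>z. z \<in> S \<Longrightarrow> (a z, b z) \<in> U"
  shows "(\<lambda>z. F (a z, b z)) holomorphic_on S"
proof -
  have "(\<lambda>z. F (a z, b z)) field_differentiable at z" if z: "z \<in> S" for z
  proof -
    obtain a' where "(a has_field_derivative a') (at z)"
      using holomorphic_on_imp_differentiable_at[OF a \<open>open S\<close> z] by (auto simp: field_differentiable_def)
    hence a: "(a has_derivative (*) a') (at z)" by (simp add: has_field_derivative_def)
    obtain b' where "(b has_field_derivative b') (at z)"
      using holomorphic_on_imp_differentiable_at[OF b \<open>open S\<close> z] by (auto simp: field_differentiable_def)
    hence b: "(b has_derivative (*) b') (at z)" by (simp add: has_field_derivative_def)
    obtain c1 c2 where F: "(F has_derivative (\<lambda>h. c1 * fst h + c2 * snd h)) (at (a z, b z))"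
      using F sub[OF z] unfolding holomorphic2_on_altdef by blast
    have "(*) (c1 * a' + c2 * b') = (\<lambda>h. c1 * (a' * h) + c2 * (b' * h))"
      by (simp add: fun_eq_iff algebra_simps)
    hence "((\<lambda>z. F (a z, b z)) has_derivative (*) (c1 * a' + c2 * b')) (at z)"
      using has_derivative_compose[OF has_derivative_Pair[OF a b] F] by simp
    thus ?thesis by (auto simp: field_differentiable_def has_field_derivative_def)
  qed
  thus ?thesis by (simp add: holomorphic_onI field_differentiable_at_within)
qed

lemma holomorphic2_on_add:
  assumes f: "holomorphic2_on f U" and g: "holomorphic2_on g U"
  shows "holomorphic2_on (\<lambda>p. f p + g p) U"
proof -
  have "holomorphic2_on (\<lambda>p. fst p + snd p) UNIV"
    unfolding holomorphic2_on_altdef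
    by (intro ballI exI[of _ 1]) (auto intro!: derivative_eq_intros)
  from holomorphic2_on_compose2[OF this f g] show ?thesis by simp
qed

lemma holomorphic2_on_mult:
  assumes f: "holomorphic2_on f U" and g: "holomorphic2_on g U"
  shows "holomorphic2_on (\<lambda>p. f p * g p) U"
proof -
  have "holomorphic2_on (\<lambda>p. fst p * snd p) UNIV"
    unfolding holomorphic2_on_altdef
  proof
    fix p :: "complex \<times> complex"
    have "((\<lambda>p. fst p * snd p) has_derivative (\<lambda>h. snd p * fst h + fst p * snd h)) (at p)"
      by (auto intro!: derivative_eq_intros simp: algebra_simps)
    thus "\<exists>a b. ((\<lambda>p. fst p * snd p) has_derivative (\<lambda>h. a * fst h + b * snd h)) (at p)"
      by blast
  qed
  from holomorphic2_on_compose2[OF this f g] show ?thesis by simp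
qed

lemma holomorphic2_on_diff:
  assumes f: "holomorphic2_on f U" and g: "holomorphic2_on g U"
  shows "holomorphic2_on (\<lambda>p. f p - g p) U"
  using holomorphic2_on_add[OF f holomorphic2_on_mult[OF holomorphic2_on_const[of "-1"] g]]
  by simp

lemma holomorphic2_on_sum:
  assumes "\<And>i. i \<in> I \<Longrightarrow> holomorphic2_on (f i) U"
  shows "holomorphic2_on (\<lambda>p. \<Sum>i\<in>I. f i p) U"
  using assms
  by (induction I rule: infinite_finite_induct)
     (auto intro!: holomorphic2_on_add holomorphic2_on_const)

lemma holomorphic2_on_divide:
  assumes f: "holomorphic2_on f U" and g: "holomorphic2_on g U" and "\<And>p. p \<in> U \<Longrightarrow> g p \<noteq> 0"
  shows "holomorphic2_on (\<lambda>p. f p / g p) U"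
proof -
  have "inverse holomorphic_on (- {0})"
    by (intro holomorphic_intros) auto
  from holomorphic2_on_mult[OF f holomorphic2_on_compose1[OF this _ g]] assms(3)
  show ?thesis by (auto simp: divide_inverse)
qed

named_theorems holomorphic2_intros
lemmas [holomorphic2_intros] =
  holomorphic2_on_const holomorphic2_on_fst holomorphic2_on_snd holomorphic2_on_add
  holomorphic2_on_diff holomorphic2_on_mult holomorphic2_on_sum holomorphic2_on_divide

section \<open>Continuity, Cauchy estimates, uniform limits and the identity theorem\<close>

lemma holomorphic2_on_imp_continuous_on: "holomorphic2_on f U \<Longrightarrow> continuous_on U f"
  unfolding holomorphic2_on_altdef
  by (meson continuous_at_imp_continuous_on has_derivative_continuous)

lemma holomorphic2_on_cong:
  assumes f: "holomorphic2_on f U" and "open U" and eq: "\<And>p. p \<in> U \<Longrightarrow> f p = g p"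
  shows "holomorphic2_on g U"
  unfolding holomorphic2_on_altdef
proof
  fix p assume p: "p \<in> U"
  obtain a b where "(f has_derivative (\<lambda>h. a * fst h + b * snd h)) (at p)"
    using f p unfolding holomorphic2_on_altdef by blast
  from has_derivative_transform_within_open[OF this \<open>open U\<close> p eq]
  show "\<exists>a b. (g has_derivative (\<lambda>h. a * fst h + b * snd h)) (at p)" by blast
qed

text \<open>The coefficients a and b are the derivatives of the two coordinate slices through q, so
  the one-variable Cauchy inequality on a circle of radius r bounds each of them.\<close>

lemma holomorphic2_Cauchy_bound:
  assumes f: "holomorphic2_on f U"
    and der: "(f has_derivative (\<lambda>h. a * fst h + b * snd h)) (at q)"
    and "r > 0" and sub: "cball q r \<subseteq> U" and bound: "\<And>p. p \<in> U \<Longrightarrow> norm (f p) \<le> e"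
  shows "norm a \<le> e / r" "norm b \<le> e / r"
proof -
  obtain x y where q: "q = (x, y)" by force
  define k where "k = (\<lambda>z. f (z, y))"
  define l where "l = (\<lambda>z. f (x, z))"
  have subk: "(z, y) \<in> U" if "z \<in> cball x r" for z
    using that sub by (auto simp: q dist_Pair_Pair)
  have subl: "(x, z) \<in> U" if "z \<in> cball y r" for z
    using that sub by (auto simp: q dist_Pair_Pair)
  have contf: "continuous_on U f" by (rule holomorphic2_on_imp_continuous_on[OF f])
  have "((\<lambda>z. (z, y)) has_derivative (\<lambda>h. (h, 0))) (at x)"
    by (auto intro!: derivative_eq_intros)
  from has_derivative_compose[OF this der[unfolded q]] have "(k has_derivative (*) a) (at x)"
    by (simp add: k_def)
  hence "deriv k x = a"
    by (intro DERIV_imp_deriv) (simp add: has_field_derivative_def)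
  moreover have "norm ((deriv ^^ 1) k x) \<le> fact 1 * e / r ^ 1"
  proof (rule Cauchy_inequality)
    show "k holomorphic_on ball x r" unfolding k_def
      by (rule holomorphic2_on_imp_holomorphic_on[OF f])
         (auto intro!: holomorphic_intros subk)
    show "continuous_on (cball x r) k" unfolding k_def
      by (rule continuous_on_compose2[OF contf])
         (auto intro!: continuous_intros subk)
    show "norm (k z) \<le> e" if "norm (x - z) = r" for z
      using that by (auto simp: k_def dist_norm intro!: bound subk)
  qed (use \<open>r > 0\<close> in auto)
  ultimately show "norm a \<le> e / r" by simp
  have "((\<lambda>z. (x, z)) has_derivative (\<lambda>h. (0, h))) (at y)"
    by (auto intro!: derivative_eq_intros)
  from has_derivative_compose[OF this der[unfolded q]] have "(l has_derivative (*) b) (at y)"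
    by (simp add: l_def)
  hence "deriv l y = b"
    by (intro DERIV_imp_deriv) (simp add: has_field_derivative_def)
  moreover have "norm ((deriv ^^ 1) l y) \<le> fact 1 * e / r ^ 1"
  proof (rule Cauchy_inequality)
    show "l holomorphic_on ball y r" unfolding l_def
      by (rule holomorphic2_on_imp_holomorphic_on[OF f])
         (auto intro!: holomorphic_intros subl)
    show "continuous_on (cball y r) l" unfolding l_def
      by (rule continuous_on_compose2[OF contf])
         (auto intro!: continuous_intros subl)
    show "norm (l z) \<le> e" if "norm (y - z) = r" for z
      using that by (auto simp: l_def dist_norm intro!: bound subl)
  qed (use \<open>r > 0\<close> in auto)
  ultimately show "norm b \<le> e / r" by simp
qed

text \<open>Cauchy estimates applied to \<open>f m - f n\<close> show that the partial derivatives
  converge uniformly on a smaller ball; the theorem on differentiating sequences then gives a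
  derivative of the limit that is again complex linear.\<close>

lemma holomorphic2_on_uniform_limit:
  assumes f: "\<And>n::nat. holomorphic2_on (f n) U"
    and lim: "\<And>p. p \<in> U \<Longrightarrow> \<exists>V. open V \<and> p \<in> V \<and> V \<subseteq> U \<and> uniform_limit V f g sequentially"
  shows "holomorphic2_on g U"
  unfolding holomorphic2_on_altdef
proof
  fix p assume "p \<in> U"
  then obtain V where V: "open V" "p \<in> V" "V \<subseteq> U" "uniform_limit V f g sequentially"
    using lim by blast
  obtain R where R: "R > 0" "ball p R \<subseteq> V" using V openE by blast
  \<comment> \<open>Half the radius leaves room for a closed ball of radius r around every point of
    the ball S.\<close>
  define r where "r = R / 2"
  have r: "r > 0" using R by (simp add: r_def)
  define S where "S = ball p r"
  have sub: "cball q r \<subseteq> V" if "q \<in> S" for q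
  proof
    fix z assume "z \<in> cball q r"
    hence "dist p z < R"
      using that dist_triangle[of p z q] unfolding S_def r_def by auto
    thus "z \<in> V" using R by auto
  qed
  have SV: "S \<subseteq> V" using sub r by fastforce
  have "\<forall>n. \<exists>a b. \<forall>q\<in>V. (f n has_derivative (\<lambda>h. a q * fst h + b q * snd h)) (at q)"
    using f V(3) unfolding holomorphic2_on_altdef by (metis subsetD)
  then obtain a b where ab:
    "\<And>n q. q \<in> V \<Longrightarrow> (f n has_derivative (\<lambda>h. a n q * fst h + b n q * snd h)) (at q)"
    by metis
  have UC: "uniformly_Cauchy_on V f"
    using V(4) uniformly_convergent_Cauchy uniformly_convergent_on_def by blast
  have est: "\<exists>N. \<forall>q\<in>S. \<forall>m\<ge>N. \<forall>n\<ge>N. norm (a m q - a n q) < e \<and> norm (b m q - b n q) < e"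
    if "e > 0" for e
  proof -
    \<comment> \<open>With this bound on \<open>f m - f n\<close>, the Cauchy estimate of radius r
      gives e / 2 for the partial derivatives.\<close>
    have "e * r / 2 > 0" using that r by simp
    then obtain N where N: "\<And>x m n. x \<in> V \<Longrightarrow> m \<ge> N \<Longrightarrow> n \<ge> N \<Longrightarrow> dist (f m x) (f n x) < e * r / 2"
      using UC unfolding uniformly_Cauchy_on_def by metis
    have "norm (a m q - a n q) < e \<and> norm (b m q - b n q) < e"
      if q: "q \<in> S" and mn: "m \<ge> N" "n \<ge> N" for q m n
    proof -
      have hol: "holomorphic2_on (\<lambda>p. f m p - f n p) V"
        by (intro holomorphic2_intros holomorphic2_on_subset[OF f V(3)])
      have "((\<lambda>p. f m p - f n p) has_derivative
              (\<lambda>h. (a m q * fst h + b m q * snd h) - (a n q * fst h + b n q * snd h))) (at q)"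
        using q SV by (intro has_derivative_diff ab) auto
      hence der: "((\<lambda>p. f m p - f n p) has_derivative
              (\<lambda>h. (a m q - a n q) * fst h + (b m q - b n q) * snd h)) (at q)"
        by (simp add: algebra_simps)
      have "norm (f m p - f n p) \<le> e * r / 2" if "p \<in> V" for p
        using N[OF that mn] by (simp add: dist_norm)
      from holomorphic2_Cauchy_bound[OF hol der r sub[OF q] this]
      show ?thesis using r that \<open>e > 0\<close> by auto
    qed
    thus ?thesis by blast
  qed
  have "uniformly_Cauchy_on S a" "uniformly_Cauchy_on S b"
    unfolding uniformly_Cauchy_on_def dist_norm using est by meson+
  then obtain A B where A: "uniform_limit S a A sequentially" and B: "uniform_limit S b B sequentially"
    using Cauchy_uniformly_convergent uniformly_convergent_on_def by metis
  have "\<exists>g0. \<forall>x\<in>S. (\<lambda>n. f n x) \<longlonglongrightarrow> g0 x \<and>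
           (g0 has_derivative (\<lambda>h. A x * fst h + B x * snd h)) (at x within S)"
  proof (rule has_derivative_sequence)
    show "convex S" by (simp add: S_def)
    show "(f n has_derivative (\<lambda>h. a n x * fst h + b n x * snd h)) (at x within S)"
      if "x \<in> S" for n x
      using that SV by (blast intro: has_derivative_at_withinI[OF ab])
    show "\<forall>\<^sub>F n in sequentially. \<forall>x\<in>S. \<forall>h. norm (a n x * fst h + b n x * snd h -
            (A x * fst h + B x * snd h)) \<le> e * norm h" if "e > 0" for e
    proof -
      have e: "e / 2 > 0" using that by simp
      from uniform_limitD[OF A e] uniform_limitD[OF B e] show ?thesis
      proof eventually_elim
        case (elim n)
        show ?case
        proof (intro ballI allI)
          fix x h assume x: "x \<in> S"
          have "norm (a n x * fst h + b n x * snd h - (A x * fst h + B x * snd h)) =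
                norm ((a n x - A x) * fst h + (b n x - B x) * snd h)"
            by (simp add: algebra_simps)
          also have "\<dots> \<le> norm (a n x - A x) * norm (fst h) + norm (b n x - B x) * norm (snd h)"
            by (metis norm_mult norm_triangle_ineq)
          also have "\<dots> \<le> e / 2 * norm h + e / 2 * norm h"
            using elim x that
            by (intro add_mono mult_mono norm_fst_le[of "fst h" "snd h", simplified]
                  norm_snd_le[of "snd h" "fst h", simplified])
               (auto simp: dist_norm less_imp_le)
          finally show "norm (a n x * fst h + b n x * snd h - (A x * fst h + B x * snd h)) \<le> e * norm h"
            by simp
        qed
      qed
    qed
    show "p \<in> S" using r by (simp add: S_def)
    show "(\<lambda>n. f n p) \<longlonglongrightarrow> g p"
      using V by (auto intro: tendsto_uniform_limitI)
  qed
  then obtain g0 where g0: "\<And>x. x \<in> S \<Longrightarrow> (\<lambda>n. f n x) \<longlonglongrightarrow> g0 x"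
    "\<And>x. x \<in> S \<Longrightarrow> (g0 has_derivative (\<lambda>h. A x * fst h + B x * snd h)) (at x within S)"
    by blast
  have pS: "p \<in> S" "open S" using r by (auto simp: S_def)
  \<comment> \<open>The sequence theorem supplies its own limit function, which is identified with g
    by uniqueness of limits.\<close>
  have "g0 x = g x" if "x \<in> S" for x
    using LIMSEQ_unique[OF g0(1)[OF that] tendsto_uniform_limitI[OF V(4)]] that SV by blast
  moreover have "(g0 has_derivative (\<lambda>h. A p * fst h + B p * snd h)) (at p)"
    using g0(2)[OF pS(1)] by (simp only: at_within_open[OF pS])
  ultimately have "(g has_derivative (\<lambda>h. A p * fst h + B p * snd h)) (at p)"
    using has_derivative_transform_within_open[OF _ pS(2) pS(1)] by blast
  thus "\<exists>a b. (g has_derivative (\<lambda>h. a * fst h + b * snd h)) (at p)" by blast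
qed

lemma holomorphic2_on_suminf:
  fixes u :: "nat \<Rightarrow> complex \<times> complex \<Rightarrow> complex"
  assumes u: "\<And>n. holomorphic2_on (u n) U"
    and M: "\<And>p. p \<in> U \<Longrightarrow> \<exists>V M. open V \<and> p \<in> V \<and> V \<subseteq> U \<and> summable M \<and>
                (\<forall>n. \<forall>q\<in>V. norm (u n q) \<le> M n)"
  shows "holomorphic2_on (\<lambda>p. \<Sum>n. u n p) U"
proof (rule holomorphic2_on_uniform_limit[where f = "\<lambda>n p. \<Sum>i<n. u i p"])
  show "holomorphic2_on (\<lambda>p. \<Sum>i<n. u i p) U" for n
    by (intro holomorphic2_intros u)
  fix p assume "p \<in> U"
  then obtain V M where VM: "open V" "p \<in> V" "V \<subseteq> U" "summable M" "\<And>n q. q \<in> V \<Longrightarrow> norm (u n q) \<le> M n"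
    using M by meson
  have "uniform_limit V (\<lambda>n p. \<Sum>i<n. u i p) (\<lambda>p. \<Sum>n. u n p) sequentially"
    using VM by (intro Weierstrass_m_test) auto
  thus "\<exists>V. open V \<and> p \<in> V \<and> V \<subseteq> U \<and>
          uniform_limit V (\<lambda>n p. \<Sum>i<n. u i p) (\<lambda>p. \<Sum>n. u n p) sequentially"
    using VM by blast
qed

text \<open>Restrict F to the complex line through z and a point of V. Convexity of U makes the
  parameter set of this line convex, hence connected, and the one-variable identity theorem
  applies.\<close>

lemma holomorphic2_identity:
  assumes F: "holomorphic2_on F U" and U: "open U" "convex U" and V: "open V" "V \<noteq> {}" "V \<subseteq> U"
    and zero: "\<And>p. p \<in> V \<Longrightarrow> F p = 0" and z: "z \<in> U"
  shows "F z = 0"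
proof -
  obtain a where a: "a \<in> V" using V by blast
  define c where "c = (\<lambda>t. (fst a + t * (fst z - fst a), snd a + t * (snd z - snd a)))"
  define S where "S = c -` U"
  have cont: "continuous_on A c" for A
    unfolding c_def by (intro continuous_intros)
  have oS: "open S" unfolding S_def
    using continuous_on_open_vimage[OF open_UNIV, of c] cont U(1) by auto
  have c_aff: "c ((1 - u) *\<^sub>R x + u *\<^sub>R y) = (1 - u) *\<^sub>R c x + u *\<^sub>R c y" for u x y
    by (simp add: c_def prod_eq_iff algebra_simps scaleR_conv_of_real)
  have cS: "convex S"
    unfolding convex_alt S_def using U(2) c_aff unfolding convex_alt by auto
  have oV: "open (c -` V)"
    using continuous_on_open_vimage[OF open_UNIV, of c] cont V(1) by auto
  have c0: "c 0 = a" and c1: "c 1 = z" by (auto simp: c_def)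
  have "(\<lambda>t. F (fst (c t), snd (c t))) holomorphic_on S"
    by (rule holomorphic2_on_imp_holomorphic_on[OF F _ _ oS])
       (auto simp: c_def S_def intro!: holomorphic_intros)
  hence hol: "(\<lambda>t. F (c t)) holomorphic_on S" by simp
  have "F (c 1) = 0"
  proof (rule analytic_continuation_open[of "c -` V" S "\<lambda>t. F (c t)" "\<lambda>_. 0"])
    show "c -` V \<noteq> {}" using c0 a by auto
    show "c -` V \<subseteq> S" using V by (auto simp: S_def)
    show "connected S" using cS convex_connected by blast
    show "1 \<in> S" using z by (simp add: S_def c1)
  qed (use oS oV hol zero in auto)
  thus ?thesis by (simp add: c1)
qed

section \<open>Continuation of weighted double Dirichlet series\<close>

lemma norm_pochhammer_le:
  fixes z :: complex
  assumes "norm z \<le> A"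
  shows "norm (pochhammer z k) \<le> pochhammer A k"
proof (induction k)
  case (Suc k)
  have "A \<ge> 0" using assms norm_ge_zero[of z] by linarith
  have "norm (z + of_nat k) \<le> A + of_nat k"
    using norm_triangle_ineq[of z "of_nat k"] assms by simp
  moreover have "pochhammer A k \<ge> 0"
    using \<open>A \<ge> 0\<close> pochhammer_pos[of A k] by (cases "A = 0") (auto simp: pochhammer_0_left)
  ultimately show ?case
    using Suc by (simp add: pochhammer_Suc norm_mult mult_mono)
qed simp

text \<open>This is the binomial series of (1 - x)^(-A) at x = 1/2, the largest value of 1 / (m + 1)
  for m \<ge> 1.\<close>

lemma summable_pochhammer_geometric:
  fixes A :: real
  shows "summable (\<lambda>k. pochhammer A k / fact k * (1/2) ^ k)"
proof -
  have "(\<lambda>k. (-A gchoose k) * (-1/2) ^ k) sums (1 + (-1/2)) powr (-A)"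
    by (rule gen_binomial_real) simp
  also have "(\<lambda>k. (-A gchoose k) * (-1/2) ^ k) = (\<lambda>k. pochhammer A k / fact k * (1/2) ^ k)"
    by (simp add: fun_eq_iff gbinomial_pochhammer power_minus' field_simps
          flip: power_mult_distrib)
  finally show ?thesis by (rule sums_summable)
qed

text \<open>The error of a K-term expansion with base \<open>Suc m\<close>; the index is chosen so
  that it matches \<open>zeta_term m\<close>, which is also a power of \<open>Suc m\<close>.\<close>

definition binomial_remainder :: "nat \<Rightarrow> nat \<Rightarrow> complex \<Rightarrow> complex" where
  "binomial_remainder K m s = of_nat m powr (1 - s) - of_nat (Suc m) powr (1 - s) -
     (\<Sum>k<K. pochhammer (s - 1) (Suc k) / fact (Suc k) * of_nat (Suc m) powr (-(s + of_nat k)))"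

lemma norm_of_nat_powr: "m > 0 \<Longrightarrow> norm (of_nat m powr s :: complex) = real m powr Re s"
  using norm_powr_real_powr[of "of_nat m" s] by simp

text \<open>The remainder is the tail of a binomial series from exponent K + 1 on. Its leading power
  is (m + 1)^(-s - K), and each further term gains a factor 1 / (m + 1) \<le> 1/2, so the bound is
  uniform in m and in s on a disc.\<close>

lemma binomial_remainder_bound:
  "\<exists>C. \<forall>m\<ge>1. \<forall>s. norm (s - 1) \<le> A \<longrightarrow>
       norm (binomial_remainder K m s) \<le> C * real (Suc m) powr (- Re s - real K)"
proof -
  define d where "d = (\<lambda>k. pochhammer A k / fact k)"
  have sumd: "summable (\<lambda>i. d (i + Suc K) * (1/2) ^ i)"
  proof -
    have "summable (\<lambda>i. d (i + Suc K) * (1/2) ^ (i + Suc K))"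
      unfolding summable_iff_shift[of "\<lambda>i. d i * (1/2) ^ i"]
      using summable_pochhammer_geometric[of A] by (simp add: d_def)
    from summable_mult[OF this, of "2 ^ Suc K"] show ?thesis
      by (simp add: power_add field_simps)
  qed
  define C where "C = (\<Sum>i. d (i + Suc K) * (1/2) ^ i)"
  have "norm (binomial_remainder K m s) \<le> C * real (Suc m) powr (- Re s - real K)"
    if m: "m \<ge> 1" and s: "norm (s - 1) \<le> A" for m s
  proof -
    \<comment> \<open>The terms of the expansion of m^(1-s) = ((m + 1) - 1)^(1-s), which converges
      because 1 < m + 1.\<close>
    define t where "t = (\<lambda>k. pochhammer (s - 1) k / fact k * of_nat (Suc m) powr (1 - s - of_nat k))"
    have "(\<lambda>k. ((1 - s) gchoose k) * of_real (real (Suc m)) powr (1 - s - of_nat k) * of_real (-1) ^ k)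
            sums of_real (real (Suc m) + (-1)) powr (1 - s)"
      using m by (intro gen_binomial_complex'') auto
    also have "(\<lambda>k. ((1 - s) gchoose k) * of_real (real (Suc m)) powr (1 - s - of_nat k) * of_real (-1) ^ k) = t"
      by (simp add: fun_eq_iff gbinomial_pochhammer t_def power_mult_distrib[symmetric] field_simps
            flip: power_mult_distrib)
    finally have "t sums (of_nat m powr (1 - s))" by simp
    hence "(\<lambda>i. t (i + Suc K)) sums (of_nat m powr (1 - s) - (\<Sum>k<Suc K. t k))"
      by (rule sums_split_initial_segment)
    also have "of_nat m powr (1 - s) - (\<Sum>k<Suc K. t k) = binomial_remainder K m s"
      unfolding binomial_remainder_def sum.lessThan_Suc_shift
      by (simp add: t_def algebra_simps)
    finally have sums: "(\<lambda>i. t (i + Suc K)) sums binomial_remainder K m s" .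
    have le: "norm (t (i + Suc K)) \<le> d (i + Suc K) * (1/2) ^ i * real (Suc m) powr (- Re s - real K)" for i
    proof -
      have "norm (t (i + Suc K)) = norm (pochhammer (s - 1) (i + Suc K)) / fact (i + Suc K) *
              real (Suc m) powr (- Re s - real K - real i)"
      proof -
        have e: "1 - s - of_nat (i + Suc K) = - s - of_nat K - of_nat i" by simp
        show ?thesis
          unfolding t_def e by (simp add: norm_mult norm_divide norm_of_nat_powr del: of_nat_Suc)
      qed
      also have "real (Suc m) powr (- Re s - real K - real i) =
                 real (Suc m) powr (- Re s - real K) * (1 / real (Suc m)) ^ i"
        by (simp add: powr_diff powr_realpow power_divide del: of_nat_Suc)
      also have "norm (pochhammer (s - 1) (i + Suc K)) / fact (i + Suc K) * \<dots> \<le>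
                 d (i + Suc K) * (real (Suc m) powr (- Re s - real K) * (1/2) ^ i)"
        unfolding d_def using m s order.trans[OF norm_ge_zero norm_pochhammer_le[OF s]]
        by (intro mult_mono divide_right_mono norm_pochhammer_le power_mono frac_le) auto
      finally show ?thesis by (simp add: mult_ac)
    qed
    have sum2: "summable (\<lambda>i. d (i + Suc K) * (1/2) ^ i * real (Suc m) powr (- Re s - real K))"
      by (intro summable_mult2 sumd)
    have "norm (binomial_remainder K m s) \<le>
            (\<Sum>i. d (i + Suc K) * (1/2) ^ i * real (Suc m) powr (- Re s - real K))"
      using norm_suminf_le[OF le sum2] sums_unique[OF sums] by simp
    also have "\<dots> = C * real (Suc m) powr (- Re s - real K)"
      unfolding C_def by (rule suminf_mult2[OF sumd, symmetric])
    finally show ?thesis .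
  qed
  thus ?thesis by blast
qed

section \<open>Convergence and holomorphy of weighted double sums\<close>

lemma summable_Suc_powr:
  assumes "\<delta> > 0"
  shows "summable (\<lambda>j. real (Suc j) powr (-1-\<delta>))"
  using assms unfolding summable_Suc_iff[of "\<lambda>j. real j powr (-1-\<delta>)"] summable_real_powr_iff by simp

text \<open>The exponent x is split as (x - 1 - \<delta>) + (1 + \<delta>). In the first power n + j
  + 1 is bounded below by n, in the second by j + 1: just enough decay is spent on summing over j
  and the rest is kept for n.\<close>

lemma powr_tail_bound:
  fixes a :: "nat \<Rightarrow> complex"
  assumes a: "\<And>j. norm (a j) \<le> C * real (n + Suc j) powr (-x)"
    and \<delta>: "\<delta> > 0" "x \<ge> 1 + \<delta>" and n: "n \<ge> 1"
  shows "norm (a j) \<le> C * real n powr (1 + \<delta> - x) * real (Suc j) powr (-1-\<delta>)"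
    and "norm (suminf a) \<le> C * real n powr (1 + \<delta> - x) * (\<Sum>j. real (Suc j) powr (-1-\<delta>))"
proof -
  have "0 \<le> norm (a 0)" by simp
  \<comment> \<open>The hypothesis at j = 0 forces C to be nonnegative.\<close>
  also note a[of 0]
  finally have "C * real (n + Suc 0) powr (-x) \<ge> 0" .
  hence C: "C \<ge> 0"
    using n by (simp add: zero_le_mult_iff)
  show le: "norm (a j) \<le> C * real n powr (1 + \<delta> - x) * real (Suc j) powr (-1-\<delta>)" for j
  proof -
    have "real (n + Suc j) powr (-x) = real (n + Suc j) powr (1 + \<delta> - x) * real (n + Suc j) powr (-1-\<delta>)"
      by (simp add: powr_add[symmetric])
    also have "\<dots> \<le> real n powr (1 + \<delta> - x) * real (Suc j) powr (-1-\<delta>)"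
      using n \<delta> by (intro mult_mono powr_mono2') auto
    finally show ?thesis
      using mult_left_mono[OF _ C] a[of j] by (fastforce simp: mult.assoc)
  qed
  have sm: "summable (\<lambda>j. real (Suc j) powr (-1-\<delta>))"
    by (rule summable_Suc_powr[OF \<delta>(1)])
  from summable_mult[OF this, of "C * real n powr (1 + \<delta> - x)"]
  have sm': "summable (\<lambda>j. C * real n powr (1 + \<delta> - x) * real (Suc j) powr (-1-\<delta>))" by simp
  show "norm (suminf a) \<le> C * real n powr (1 + \<delta> - x) * (\<Sum>j. real (Suc j) powr (-1-\<delta>))"
    using norm_suminf_le[OF le sm'] suminf_mult[OF sm] by simp
qed

text \<open>The domain of absolute convergence of zeta_2, translated by K in s2, because a remainder
  of order K decays like m^(-s2 - K). The regions increase with K and exhaust C^2.\<close>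

definition shifted_region :: "nat \<Rightarrow> (complex \<times> complex) set" where
  "shifted_region K = {p. Re (snd p) + real K > 1 \<and> Re (fst p) + Re (snd p) + real K > 2}"

lemma open_shifted_region: "open (shifted_region K)"
  unfolding shifted_region_def
  by (intro open_Collect_conj open_Collect_less continuous_intros)

lemma convex_shifted_region: "convex (shifted_region K)"
proof -
  have "shifted_region K = (\<lambda>p. Re (snd p)) -` {1 - real K<..} \<inter>
          (\<lambda>p. Re (fst p) + Re (snd p)) -` {2 - real K<..}"
    by (auto simp: shifted_region_def)
  thus ?thesis
    by (auto intro!: convex_Int convex_linear_vimage linearI simp: algebra_simps)
qed

text \<open>In the double zeta series n stands for n1 - 1 and j for n2 - 1; since
  \<open>zeta_term m\<close> is a power of m + 1, the inner index \<open>Suc n + j\<close> gives the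
  base n1 + n2.\<close>

definition weighted_dsum ::
  "(nat \<Rightarrow> complex) \<Rightarrow> (nat \<Rightarrow> complex \<Rightarrow> complex) \<Rightarrow> complex \<times> complex \<Rightarrow> complex" where
  "weighted_dsum w a p =
     (\<Sum>n. w n * of_nat (Suc n) powr (- fst p) * (\<Sum>j. a (Suc n + j) (snd p)))"

context
  fixes w :: "nat \<Rightarrow> complex" and a :: "nat \<Rightarrow> complex \<Rightarrow> complex" and K :: nat
  assumes w: "\<And>n. norm (w n) \<le> 1"
    and hol: "\<And>m. m \<ge> 1 \<Longrightarrow> a m holomorphic_on UNIV"
    and bound: "\<And>A. \<exists>C. \<forall>m\<ge>1. \<forall>s. norm (s - 1) \<le> A \<longrightarrow>
                   norm (a m s) \<le> C * real (Suc m) powr (- Re s - real K)"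
begin

text \<open>Two majorants on one neighbourhood, because Weierstrass' test is applied twice: B for
  the inner tails, uniformly in n, and M for the outer series.\<close>

lemma weighted_dsum_local_bound:
  assumes p: "p \<in> shifted_region K"
  shows "\<exists>V B M. open V \<and> p \<in> V \<and> V \<subseteq> shifted_region K \<and> summable B \<and> summable M \<and>
    (\<forall>q\<in>V. \<forall>n j. norm (a (Suc n + j) (snd q)) \<le> B j) \<and>
    (\<forall>q\<in>V. \<forall>n.
       norm (w n * of_nat (Suc n) powr (- fst q) * (\<Sum>j. a (Suc n + j) (snd q))) \<le> M n)"
proof -
  define \<mu> where "\<mu> = min (Re (snd p) + real K - 1) (Re (fst p) + Re (snd p) + real K - 2)"
  have \<mu>: "\<mu> > 0" "\<mu> \<le> Re (snd p) + real K - 1" "\<mu> \<le> Re (fst p) + Re (snd p) + real K - 2"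
    using p by (auto simp: \<mu>_def shifted_region_def)
  \<comment> \<open>A third of the margin keeps both inequalities strict, so that they define an
    open set. The inner sum uses up 1 + \<delta> of the total exponent, hence the outer sum
    converges like (n + 1)^(-1-\<delta>) if that exponent exceeds 2 + 2 \<delta>.\<close>
  define \<delta> where "\<delta> = \<mu> / 3"
  have \<delta>: "\<delta> > 0" "1 + \<delta> < Re (snd p) + real K" "2 + 2 * \<delta> < Re (fst p) + Re (snd p) + real K"
    using \<mu> by (simp_all add: \<delta>_def)
  define A where "A = norm (snd p - 1) + 1"
  obtain C where C: "\<And>m s. m \<ge> 1 \<Longrightarrow> norm (s - 1) \<le> A \<Longrightarrow>
      norm (a m s) \<le> C * real (Suc m) powr (- Re s - real K)"
    using bound[of A] by blast
  \<comment> \<open>The sign of C is read off from the bound at m = 1, s = 1.\<close>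
  have C0: "C \<ge> 0"
  proof -
    have "0 \<le> norm (a 1 1)" by simp
    also have "\<dots> \<le> C * real (Suc 1) powr (- Re 1 - real K)"
      by (rule C) (auto simp: A_def)
    finally show ?thesis by (simp add: zero_le_mult_iff)
  qed
  define V where "V = {q. norm (snd q - 1) < A \<and> 1 + \<delta> < Re (snd q) + real K \<and>
                          2 + 2 * \<delta> < Re (fst q) + Re (snd q) + real K}"
  define D where "D = (\<Sum>j. real (Suc j) powr (-1-\<delta>))"
  have tail: "norm (a (Suc n + j) (snd q)) \<le> C * real (Suc n + Suc j) powr (- (Re (snd q) + real K))"
    if "q \<in> V" for q n j
    using C[of "Suc n + j" "snd q"] that by (simp add: V_def)
  have x: "Re (snd q) + real K \<ge> 1 + \<delta>" if "q \<in> V" for q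
    using that by (simp add: V_def)
  have sm: "summable (\<lambda>j. real (Suc j) powr (-1-\<delta>))"
    by (rule summable_Suc_powr[OF \<delta>(1)])
  have D0: "D \<ge> 0" unfolding D_def by (intro suminf_nonneg sm) simp
  show ?thesis
  proof (rule exI[of _ V], rule exI[of _ "\<lambda>j. C * real (Suc j) powr (-1-\<delta>)"],
      rule exI[of _ "\<lambda>n. C * D * real (Suc n) powr (-1-\<delta>)"], intro conjI ballI allI)
    show "open V" unfolding V_def
      by (intro open_Collect_conj open_Collect_less continuous_intros)
    show "p \<in> V" using \<delta> by (simp add: V_def A_def)
    show "V \<subseteq> shifted_region K" using \<delta>(1) by (auto simp: V_def shifted_region_def)
    show "summable (\<lambda>j. C * real (Suc j) powr (-1-\<delta>))"
      "summable (\<lambda>n. C * D * real (Suc n) powr (-1-\<delta>))"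
      by (intro summable_mult sm)+
    fix q n j assume q: "q \<in> V"
    have "norm (a (Suc n + j) (snd q)) \<le>
            C * real (Suc n) powr (1 + \<delta> - (Re (snd q) + real K)) * real (Suc j) powr (-1-\<delta>)"
      by (rule powr_tail_bound(1)[OF tail[OF q] \<delta>(1) x[OF q]]) simp
    also have "real (Suc n) powr (1 + \<delta> - (Re (snd q) + real K)) \<le> real (Suc n) powr 0"
      using x[OF q] by (intro powr_mono) auto
    finally show "norm (a (Suc n + j) (snd q)) \<le> C * real (Suc j) powr (-1-\<delta>)"
      using C0 by (simp add: mult_left_mono mult_right_mono)
  next
    fix q n assume q: "q \<in> V"
    have "norm (w n * of_nat (Suc n) powr (- fst q) * (\<Sum>j. a (Suc n + j) (snd q))) =
          norm (w n) * real (Suc n) powr (- Re (fst q)) * norm (\<Sum>j. a (Suc n + j) (snd q))"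
      by (simp add: norm_mult norm_of_nat_powr del: of_nat_Suc)
    also have "\<dots> \<le> 1 * real (Suc n) powr (- Re (fst q)) *
                  (C * real (Suc n) powr (1 + \<delta> - (Re (snd q) + real K)) * D)"
      unfolding D_def
      by (intro mult_mono powr_tail_bound(2)[OF tail[OF q] \<delta>(1) x[OF q]] w) auto
    also have "\<dots> = C * D * real (Suc n) powr (1 + \<delta> - (Re (fst q) + Re (snd q) + real K))"
      by (simp add: powr_add[symmetric] algebra_simps)
    also have "\<dots> \<le> C * D * real (Suc n) powr (-1-\<delta>)"
      using q C0 D0 by (intro mult_left_mono powr_mono) (auto simp: V_def)
    finally show "norm (w n * of_nat (Suc n) powr (- fst q) * (\<Sum>j. a (Suc n + j) (snd q))) \<le>
                  C * D * real (Suc n) powr (-1-\<delta>)" .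
  qed
qed

lemma weighted_dsum_summable:
  assumes p: "p \<in> shifted_region K"
  shows "summable (\<lambda>n. w n * of_nat (Suc n) powr (- fst p) * (\<Sum>j. a (Suc n + j) (snd p)))"
proof -
  obtain V B M where VBM: "open V" "p \<in> V" "V \<subseteq> shifted_region K" "summable B" "summable M"
    "\<forall>q\<in>V. \<forall>n j. norm (a (Suc n + j) (snd q)) \<le> B j"
    "\<forall>q\<in>V. \<forall>n.
       norm (w n * of_nat (Suc n) powr (- fst q) * (\<Sum>j. a (Suc n + j) (snd q))) \<le> M n"
    using weighted_dsum_local_bound[OF p] by blast
  show "summable (\<lambda>n. w n * of_nat (Suc n) powr (- fst p) * (\<Sum>j. a (Suc n + j) (snd p)))"
    by (rule summable_comparison_test'[OF VBM(5), of 0]) (use VBM in blast)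
qed

lemma holomorphic2_weighted_dsum: "holomorphic2_on (weighted_dsum w a) (shifted_region K)"
proof -
  have tail: "holomorphic2_on (\<lambda>p. \<Sum>j. a (Suc n + j) (snd p)) (shifted_region K)" for n
  proof (rule holomorphic2_on_suminf)
    show "holomorphic2_on (\<lambda>p. a (Suc n + j) (snd p)) (shifted_region K)" for j
      by (rule holomorphic2_on_compose1[OF hol]) (auto intro: holomorphic2_intros)
    fix p assume p: "p \<in> shifted_region K"
    obtain V B M where VBM: "open V" "p \<in> V" "V \<subseteq> shifted_region K" "summable B" "summable M"
      "\<forall>q\<in>V. \<forall>n j. norm (a (Suc n + j) (snd q)) \<le> B j"
      "\<forall>q\<in>V. \<forall>n.
         norm (w n * of_nat (Suc n) powr (- fst q) * (\<Sum>j. a (Suc n + j) (snd q))) \<le> M n"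
      using weighted_dsum_local_bound[OF p] by blast
    show "\<exists>V M. open V \<and> p \<in> V \<and> V \<subseteq> shifted_region K \<and> summable M \<and>
            (\<forall>j. \<forall>q\<in>V. norm (a (Suc n + j) (snd q)) \<le> M j)"
      by (intro exI[of _ V] exI[of _ B] conjI VBM) (use VBM in blast)
  qed
  have "holomorphic2_on
          (\<lambda>p. \<Sum>n. w n * of_nat (Suc n) powr (- fst p) * (\<Sum>j. a (Suc n + j) (snd p)))
          (shifted_region K)"
  proof (rule holomorphic2_on_suminf)
    show "holomorphic2_on
            (\<lambda>p. w n * of_nat (Suc n) powr (- fst p) * (\<Sum>j. a (Suc n + j) (snd p)))
            (shifted_region K)" for n
    proof -
      have "(\<lambda>s. of_nat (Suc n) powr (- s) :: complex) holomorphic_on UNIV"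
        by (intro holomorphic_intros) (simp del: of_nat_Suc)
      from holomorphic2_on_compose1[OF this _ holomorphic2_on_fst] tail show ?thesis
        by (intro holomorphic2_intros) auto
    qed
    fix p assume p: "p \<in> shifted_region K"
    obtain V B M where VBM: "open V" "p \<in> V" "V \<subseteq> shifted_region K" "summable B" "summable M"
      "\<forall>q\<in>V. \<forall>n j. norm (a (Suc n + j) (snd q)) \<le> B j"
      "\<forall>q\<in>V. \<forall>n.
         norm (w n * of_nat (Suc n) powr (- fst q) * (\<Sum>j. a (Suc n + j) (snd q))) \<le> M n"
      using weighted_dsum_local_bound[OF p] by blast
    show "\<exists>V M. open V \<and> p \<in> V \<and> V \<subseteq> shifted_region K \<and> summable M \<and>
            (\<forall>n. \<forall>q\<in>V. norm (w n * of_nat (Suc n) powr (- fst q) *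
                              (\<Sum>j. a (Suc n + j) (snd q))) \<le> M n)"
      by (intro exI[of _ V] exI[of _ M] conjI VBM) (use VBM in blast)
  qed
  thus ?thesis by (simp add: weighted_dsum_def[abs_def])
qed

end

section \<open>Zeta terms, binomial remainders and the recursion between their sums\<close>

definition zeta_term :: "nat \<Rightarrow> complex \<Rightarrow> complex" where
  "zeta_term m s = of_nat (Suc m) powr (-s)"

lemma holomorphic_zeta_term: "zeta_term m holomorphic_on A"
  unfolding zeta_term_def[abs_def] by (intro holomorphic_intros) (simp del: of_nat_Suc)

lemma zeta_term_bound:
  "\<exists>C. \<forall>m\<ge>1. \<forall>s. norm (s - 1) \<le> A \<longrightarrow>
     norm (zeta_term m s) \<le> C * real (Suc m) powr (- Re s - real 0)"
  by (rule exI[of _ 1]) (simp add: zeta_term_def norm_of_nat_powr del: of_nat_Suc)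

lemma holomorphic_binomial_remainder: "m \<ge> 1 \<Longrightarrow> binomial_remainder K m holomorphic_on A"
  unfolding binomial_remainder_def[abs_def] pochhammer_prod
  by (intro holomorphic_intros) (auto simp del: of_nat_Suc)

text \<open>At s = 1 the two leading powers cancel and every Pochhammer symbol contains the factor
  0. This keeps the value on the line s2 = 1 under control during the continuation.\<close>

lemma binomial_remainder_at_1: "m \<ge> 1 \<Longrightarrow> binomial_remainder K m 1 = 0"
  by (simp add: binomial_remainder_def pochhammer_0_left del: of_nat_Suc)

lemma zeta_term_dsum:
  assumes w: "\<And>n. norm (w n) \<le> 1"
  shows "holomorphic2_on (weighted_dsum w zeta_term) (shifted_region 0)"
    and "p \<in> shifted_region 0 \<Longrightarrow>
      summable (\<lambda>n. w n * of_nat (Suc n) powr (- fst p) * (\<Sum>j. zeta_term (Suc n + j) (snd p)))"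
proof -
  show "holomorphic2_on (weighted_dsum w zeta_term) (shifted_region 0)"
    by (rule holomorphic2_weighted_dsum[OF w holomorphic_zeta_term zeta_term_bound])
  show "summable (\<lambda>n. w n * of_nat (Suc n) powr (- fst p) * (\<Sum>j. zeta_term (Suc n + j) (snd p)))"
    if "p \<in> shifted_region 0"
    by (rule weighted_dsum_summable[OF w holomorphic_zeta_term zeta_term_bound that])
qed

lemma remainder_dsum:
  assumes w: "\<And>n. norm (w n) \<le> 1"
  shows "holomorphic2_on (weighted_dsum w (binomial_remainder N)) (shifted_region N)"
    and "p \<in> shifted_region N \<Longrightarrow> summable (\<lambda>n. w n * of_nat (Suc n) powr (- fst p) *
           (\<Sum>j. binomial_remainder N (Suc n + j) (snd p)))"
proof -
  show "holomorphic2_on (weighted_dsum w (binomial_remainder N)) (shifted_region N)"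
    by (rule holomorphic2_weighted_dsum[OF w holomorphic_binomial_remainder binomial_remainder_bound])
  show "summable (\<lambda>n. w n * of_nat (Suc n) powr (- fst p) *
           (\<Sum>j. binomial_remainder N (Suc n + j) (snd p)))"
    if "p \<in> shifted_region N"
    by (rule weighted_dsum_summable[OF w holomorphic_binomial_remainder binomial_remainder_bound that])
qed

lemma summable_zeta_tail:
  assumes "Re s > 1"
  shows "summable (\<lambda>j. zeta_term (n + j) s)"
proof -
  have "summable (\<lambda>j. norm (zeta_term (n + j) s))"
    using assms by (auto simp: zeta_term_def norm_of_nat_powr summable_Suc_iff[of "\<lambda>j. real j powr (-Re s)"]
       summable_real_powr_iff summable_iff_shift[of "\<lambda>j. real (Suc j) powr (-Re s)"] add.commute[of n]
       simp del: of_nat_Suc of_nat_add)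
  thus ?thesis by (rule summable_norm_cancel)
qed

lemma shift_in_shifted_region:
  "p \<in> shifted_region K \<Longrightarrow> K \<le> L + k \<Longrightarrow> (fst p, snd p + of_nat k) \<in> shifted_region L"
  unfolding shifted_region_def by auto

text \<open>
  Summing the binomial expansion of \<open>(m - 1)\<^bsup>1-s\<^esup> - m\<^bsup>1-s\<^esup>\<close> over \<open>m > n\<close> telescopes on the left.
  Since \<open>pochhammer (s - 1) 1 = s - 1\<close>, this expresses \<open>(s - 1) \<Sum>m>n. m\<^bsup>-s\<^esup>\<close> through the same
  tails at \<open>s + 1, s + 2, \<dots>\<close> and a remainder that converges in a larger half plane.
\<close>
lemma tail_recursion:
  assumes s: "Re s > 1" and n: "n \<ge> 1"
  shows "(\<Sum>k<N. pochhammer (s - 1) (Suc k) / fact (Suc k) * (\<Sum>j. zeta_term (n + j) (s + of_nat k))) +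
           (\<Sum>j. binomial_remainder N (n + j) s) = of_nat n powr (1 - s)"
proof -
  define f where "f = (\<lambda>j. of_nat (n + j) powr (1 - s) :: complex)"
  have zt: "summable (\<lambda>j. zeta_term (n + j) (s + of_nat k))" for k
    using s by (intro summable_zeta_tail) auto
  have "f \<longlonglongrightarrow> 0"
  proof (rule tendsto_norm_zero_cancel)
    have "(\<lambda>j. real j powr (1 - Re s)) \<longlonglongrightarrow> 0"
      using s by (intro tendsto_neg_powr filterlim_real_sequentially) auto
    hence "(\<lambda>j. real (n + j) powr (1 - Re s)) \<longlonglongrightarrow> 0"
      unfolding add.commute[of n] by (rule LIMSEQ_ignore_initial_segment)
    thus "(\<lambda>j. norm (f j)) \<longlonglongrightarrow> 0"
      using n by (simp add: f_def norm_of_nat_powr del: of_nat_add)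
  qed
  from telescope_sums'[OF this] have "(\<lambda>j. f j - f (Suc j)) sums of_nat n powr (1 - s)"
    by (simp add: f_def)
  moreover have "(\<lambda>j. \<Sum>k<N. pochhammer (s - 1) (Suc k) / fact (Suc k) * zeta_term (n + j) (s + of_nat k)) sums
     (\<Sum>k<N. pochhammer (s - 1) (Suc k) / fact (Suc k) * (\<Sum>j. zeta_term (n + j) (s + of_nat k)))"
    by (intro sums_sum sums_mult summable_sums zt)
  ultimately have "(\<lambda>j. (f j - f (Suc j)) -
      (\<Sum>k<N. pochhammer (s - 1) (Suc k) / fact (Suc k) * zeta_term (n + j) (s + of_nat k))) sums
     (of_nat n powr (1 - s) -
     (\<Sum>k<N. pochhammer (s - 1) (Suc k) / fact (Suc k) * (\<Sum>j. zeta_term (n + j) (s + of_nat k))))"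
    by (rule sums_diff)
  also have "(\<lambda>j. (f j - f (Suc j)) -
      (\<Sum>k<N. pochhammer (s - 1) (Suc k) / fact (Suc k) * zeta_term (n + j) (s + of_nat k))) =
      (\<lambda>j. binomial_remainder N (n + j) s)"
    by (simp add: fun_eq_iff binomial_remainder_def f_def zeta_term_def del: of_nat_Suc of_nat_add)
  finally show ?thesis by (simp add: sums_iff algebra_simps)
qed

text \<open>This is \<open>tail_recursion\<close> at n + 1, multiplied by the weight and by (n +
  1)^(-s1) and summed over n. Each of the finitely many series converges by itself, so the sums may
  be interchanged.\<close>

lemma dsum_recursion:
  assumes w: "\<And>n. norm (w n) \<le> 1" and p: "p \<in> shifted_region 0"
  shows "(\<Sum>k<N. pochhammer (snd p - 1) (Suc k) / fact (Suc k) *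
             weighted_dsum w zeta_term (fst p, snd p + of_nat k)) +
           weighted_dsum w (binomial_remainder N) p =
         (\<Sum>n. w n * of_nat (Suc n) powr (1 - fst p - snd p))"
proof -
  have pk: "(fst p, snd p + of_nat k) \<in> shifted_region 0" for k
    using shift_in_shifted_region[OF p] by simp
  have pN: "p \<in> shifted_region N" using p by (auto simp: shifted_region_def)
  define W where "W = (\<lambda>n. w n * of_nat (Suc n) powr (- fst p))"
  have zt: "(\<lambda>n. W n * (\<Sum>j. zeta_term (Suc n + j) (snd p + of_nat k))) sums
              weighted_dsum w zeta_term (fst p, snd p + of_nat k)" for k
    using summable_sums[OF zeta_term_dsum(2)[OF w pk[of k]]]
    by (simp add: weighted_dsum_def W_def)
  have rt: "(\<lambda>n. W n * (\<Sum>j. binomial_remainder N (Suc n + j) (snd p))) sums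
              weighted_dsum w (binomial_remainder N) p"
    using summable_sums[OF remainder_dsum(2)[OF w pN]]
    by (simp add: weighted_dsum_def W_def)
  have "(\<lambda>n. (\<Sum>k<N. pochhammer (snd p - 1) (Suc k) / fact (Suc k) *
             (W n * (\<Sum>j. zeta_term (Suc n + j) (snd p + of_nat k)))) +
             W n * (\<Sum>j. binomial_remainder N (Suc n + j) (snd p))) sums
        ((\<Sum>k<N. pochhammer (snd p - 1) (Suc k) / fact (Suc k) *
             weighted_dsum w zeta_term (fst p, snd p + of_nat k)) +
           weighted_dsum w (binomial_remainder N) p)"
    by (intro sums_add sums_sum sums_mult zt rt)
  also have "(\<lambda>n. (\<Sum>k<N. pochhammer (snd p - 1) (Suc k) / fact (Suc k) *
             (W n * (\<Sum>j. zeta_term (Suc n + j) (snd p + of_nat k)))) +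
             W n * (\<Sum>j. binomial_remainder N (Suc n + j) (snd p))) =
           (\<lambda>n. w n * of_nat (Suc n) powr (1 - fst p - snd p))"
  proof
    fix n
    have "(\<Sum>k<N. pochhammer (snd p - 1) (Suc k) / fact (Suc k) *
             (W n * (\<Sum>j. zeta_term (Suc n + j) (snd p + of_nat k)))) +
             W n * (\<Sum>j. binomial_remainder N (Suc n + j) (snd p)) =
          W n * ((\<Sum>k<N. pochhammer (snd p - 1) (Suc k) / fact (Suc k) *
             (\<Sum>j. zeta_term (Suc n + j) (snd p + of_nat k))) +
             (\<Sum>j. binomial_remainder N (Suc n + j) (snd p)))"
      unfolding distrib_left sum_distrib_left by (simp only: mult_ac)
    also have "\<dots> = W n * of_nat (Suc n) powr (1 - snd p)"
      using p by (subst tail_recursion) (auto simp: shifted_region_def)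
    also have "\<dots> = w n * of_nat (Suc n) powr (1 - fst p - snd p)"
      by (simp add: W_def powr_add[symmetric] algebra_simps del: of_nat_Suc)
    finally show "(\<Sum>k<N. pochhammer (snd p - 1) (Suc k) / fact (Suc k) *
             (W n * (\<Sum>j. zeta_term (Suc n + j) (snd p + of_nat k)))) +
             W n * (\<Sum>j. binomial_remainder N (Suc n + j) (snd p)) =
           w n * of_nat (Suc n) powr (1 - fst p - snd p)" .
  qed
  finally show ?thesis by (simp add: sums_iff)
qed

text \<open>
  The factor \<open>(s\<^sub>2 - 1) / \<Gamma>(s\<^sub>1 + s\<^sub>2 - 2)\<close> vanishes on all polar lines, so the recursion can be run
  with entire functions: the denominators produced by the shifts \<open>s\<^sub>2 \<mapsto> s\<^sub>2 + k\<close> cancel against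
  Pochhammer symbols.  The weights cover both \<open>\<zeta>\<close> (only \<open>n = 1\<close>) and \<open>\<zeta>\<^sub>2\<close> (all \<open>n\<close>).
  Tracking the value at \<open>s\<^sub>2 = 1\<close> yields the residue of \<open>\<zeta>\<close>.
\<close>
lemma dsum_continuation_step:
  assumes w: "\<And>n. norm (w n) \<le> 1"
    and E: "holomorphic2_on E UNIV"
    and E_eq: "\<And>p. p \<in> shifted_region 0 \<Longrightarrow> E p = rGamma (fst p + snd p - 2) *
                 (\<Sum>n. w n * of_nat (Suc n) powr (1 - fst p - snd p))"
  shows "\<exists>G. holomorphic2_on G (shifted_region N) \<and>
     (\<forall>p\<in>shifted_region 0. G p = (snd p - 1) * rGamma (fst p + snd p - 2) * weighted_dsum w zeta_term p) \<and>
     (\<forall>s. (s, 1) \<in> shifted_region N \<longrightarrow> G (s, 1) = E (s, 1))"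
proof (induction N)
  case 0
  have "holomorphic2_on (\<lambda>p. rGamma (fst p + snd p - 2)) (shifted_region 0)"
    by (rule holomorphic2_on_compose1[OF holomorphic_rGamma[of UNIV]])
       (auto intro!: holomorphic2_intros)
  hence "holomorphic2_on
      (\<lambda>p. (snd p - 1) * rGamma (fst p + snd p - 2) * weighted_dsum w zeta_term p) (shifted_region 0)"
    by (intro holomorphic2_intros zeta_term_dsum(1) w)
  \<comment> \<open>The clause about s2 = 1 is vacuous here, since \<open>shifted_region 0\<close>
    contains no such point.\<close>
  thus ?case
    by (intro exI[of _ "\<lambda>p. (snd p - 1) * rGamma (fst p + snd p - 2) * weighted_dsum w zeta_term p"])
       (auto simp: shifted_region_def)
next
  case (Suc N)
  then obtain G where G: "holomorphic2_on G (shifted_region N)"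
    and G0: "\<And>p. p \<in> shifted_region 0 \<Longrightarrow>
       G p = (snd p - 1) * rGamma (fst p + snd p - 2) * weighted_dsum w zeta_term p"
    by blast
  define R where "R = weighted_dsum w (binomial_remainder (Suc N))"
  \<comment> \<open>The recursion of order N + 1, multiplied by the reciprocal Gamma factor and
    solved for its k = 0 term. The other terms live at s2 + 1, s2 + 2, ..., and these shifts carry
    \<open>shifted_region (Suc N)\<close> into \<open>shifted_region N\<close>, where G is already
    available.\<close>
  define G' where "G' = (\<lambda>p. E p -
     (\<Sum>k<N. pochhammer (snd p - 1) (Suc k) / fact (Suc (Suc k)) *
               pochhammer (fst p + snd p - 2) (Suc k) * G (fst p, snd p + of_nat (Suc k))) -
     rGamma (fst p + snd p - 2) * R p)"
  have R1: "R (s, 1) = 0" for s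
    by (simp add: R_def weighted_dsum_def binomial_remainder_at_1)
  have rG: "holomorphic2_on (\<lambda>p. rGamma (fst p + snd p - 2)) U" for U
    by (rule holomorphic2_on_compose1[OF holomorphic_rGamma[of UNIV]])
       (auto intro!: holomorphic2_intros)
  have poch: "holomorphic2_on (\<lambda>p. pochhammer (f p) k) U" if "holomorphic2_on f U" for f k U
    using that by (induction k) (auto simp: pochhammer_Suc intro!: holomorphic2_intros)
  have "holomorphic2_on G' (shifted_region (Suc N))"
    unfolding G'_def R_def
    by (intro holomorphic2_intros poch rG holomorphic2_on_compose2[OF G]
          remainder_dsum(1) w holomorphic2_on_subset[OF E])
       (simp_all add: shift_in_shifted_region[where K = "Suc N"] del: of_nat_Suc fact_Suc)
  moreover have "G' p = (snd p - 1) * rGamma (fst p + snd p - 2) * weighted_dsum w zeta_term p"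
    if p: "p \<in> shifted_region 0" for p
  proof -
    define z where "z = fst p + snd p - 2"
    define Z where "Z = (\<lambda>k. weighted_dsum w zeta_term (fst p, snd p + of_nat k))"
    \<comment> \<open>The factor s2 - 1 + (k + 1) in G completes the first Pochhammer symbol, and
      the second one turns \<open>rGamma (z + of_nat (Suc k))\<close> into \<open>rGamma z\<close>;
      no division occurs.\<close>
    have term_eq: "pochhammer (snd p - 1) (Suc k) / fact (Suc (Suc k)) *
                 pochhammer z (Suc k) * G (fst p, snd p + of_nat (Suc k)) =
                rGamma z * (pochhammer (snd p - 1) (Suc (Suc k)) / fact (Suc (Suc k)) * Z (Suc k))" for k
    proof -
      have "G (fst p, snd p + of_nat (Suc k)) =
              (snd p - 1 + of_nat (Suc k)) * rGamma (z + of_nat (Suc k)) * Z (Suc k)"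
        using G0[OF shift_in_shifted_region[OF p, of 0 "Suc k"]]
        by (simp add: z_def Z_def algebra_simps)
      thus ?thesis
        unfolding pochhammer_rGamma[of z "Suc k"] pochhammer_Suc[of "snd p - 1" "Suc k"]
        by (simp only: mult_ac times_divide_eq_left times_divide_eq_right)
    qed
    have "E p = rGamma z * ((\<Sum>k<Suc N. pochhammer (snd p - 1) (Suc k) / fact (Suc k) * Z k) + R p)"
      using dsum_recursion[where N = "Suc N", OF w p] E_eq[OF p] by (simp add: z_def Z_def R_def)
    also have "\<dots> = (snd p - 1) * rGamma z * Z 0 +
        (\<Sum>k<N. rGamma z * (pochhammer (snd p - 1) (Suc (Suc k)) / fact (Suc (Suc k)) * Z (Suc k))) +
        rGamma z * R p"
      unfolding sum.lessThan_Suc_shift by (simp add: algebra_simps sum_distrib_left)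
    also have "\<dots> = (snd p - 1) * rGamma z * Z 0 +
        (\<Sum>k<N. pochhammer (snd p - 1) (Suc k) / fact (Suc (Suc k)) *
               pochhammer z (Suc k) * G (fst p, snd p + of_nat (Suc k))) + rGamma z * R p"
      by (simp only: term_eq)
    finally show ?thesis by (simp add: G'_def z_def Z_def)
  qed
  \<comment> \<open>On the line s2 = 1 both the Pochhammer symbols and the remainder vanish, so only
    E survives.\<close>
  moreover have "G' (s, 1) = E (s, 1)" for s
    by (simp add: G'_def R1 pochhammer_0_left)
  ultimately show ?case by blast
qed

text \<open>The stages agree on \<open>shifted_region 0\<close>, hence by the identity theorem on
  every common convex region, and glue to an entire function.\<close>

lemma dsum_continuation:
  assumes w: "\<And>n. norm (w n) \<le> 1"
    and E: "holomorphic2_on E UNIV"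
    and E_eq: "\<And>p. p \<in> shifted_region 0 \<Longrightarrow> E p = rGamma (fst p + snd p - 2) *
                 (\<Sum>n. w n * of_nat (Suc n) powr (1 - fst p - snd p))"
  shows "\<exists>G. holomorphic2_on G UNIV \<and>
    (\<forall>p\<in>shifted_region 0.
       G p = (snd p - 1) * rGamma (fst p + snd p - 2) * weighted_dsum w zeta_term p) \<and>
    (\<forall>s. G (s, 1) = E (s, 1))"
proof -
  define H where "H = (\<lambda>p. (snd p - 1) * rGamma (fst p + snd p - 2) * weighted_dsum w zeta_term p)"
  obtain G where G: "\<And>N. holomorphic2_on (G N) (shifted_region N)"
      "\<And>N p. p \<in> shifted_region 0 \<Longrightarrow> G N p = H p"
      "\<And>N s. (s, 1) \<in> shifted_region N \<Longrightarrow> G N (s, 1) = E (s, 1)"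
    using dsum_continuation_step[OF w E E_eq] unfolding H_def by metis
  have mono: "shifted_region N \<subseteq> shifted_region M" if "N \<le> M" for N M
    using that by (force simp: shifted_region_def)
  have "(2, 2) \<in> shifted_region 0" by (simp add: shifted_region_def)
  hence ne: "shifted_region 0 \<noteq> {}" by blast
  have agree: "G N p = G M p" if "p \<in> shifted_region N" "N \<le> M" for N M p
  proof -
    have "holomorphic2_on (\<lambda>p. G N p - G M p) (shifted_region N)"
      by (intro holomorphic2_intros G holomorphic2_on_subset[OF G(1) mono[OF that(2)]])
    then have "G N p - G M p = 0"
      by (rule holomorphic2_identity[where V = "shifted_region 0", OF _ open_shifted_region[of N]
            convex_shifted_region open_shifted_region ne mono])
         (simp_all add: G that)
    thus ?thesis by simp
  qed
  have ex: "\<exists>N. p \<in> shifted_region N" for p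
  proof -
    obtain N where "real N > \<bar>Re (snd p)\<bar> + \<bar>Re (fst p)\<bar> + 2" using reals_Archimedean2 by blast
    thus ?thesis by (intro exI[of _ N]) (auto simp: shifted_region_def)
  qed
  \<comment> \<open>Taking the least admissible stage makes the glued function comparable with every
    later stage.\<close>
  define L where "L = (\<lambda>p. LEAST N. p \<in> shifted_region N)"
  have L: "p \<in> shifted_region (L p)" for p unfolding L_def using ex by (rule LeastI_ex)
  define F where "F = (\<lambda>p. G (L p) p)"
  have F: "F p = G N p" if "p \<in> shifted_region N" for p N
    unfolding F_def using that by (intro agree[OF L]) (auto simp: L_def intro: Least_le)
  show ?thesis
  proof (intro exI[of _ F] conjI ballI allI)
    show "holomorphic2_on F UNIV"
      unfolding holomorphic2_on_altdef
    proof
      fix p :: "complex \<times> complex"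
      have "holomorphic2_on F (shifted_region (L p))"
        using holomorphic2_on_cong[OF G(1) open_shifted_region] F by metis
      thus "\<exists>a b. (F has_derivative (\<lambda>h. a * fst h + b * snd h)) (at p)"
        using L unfolding holomorphic2_on_altdef by blast
    qed
    show "F p = (snd p - 1) * rGamma (fst p + snd p - 2) * weighted_dsum w zeta_term p"
      if "p \<in> shifted_region 0" for p
      using F[OF that] G(2)[OF that] by (simp add: H_def)
    show "F (s, 1) = E (s, 1)" for s
      unfolding F_def by (rule G(3)[OF L])
  qed
qed

section \<open>The Riemann zeta function\<close>

text \<open>The identity theorem gives agreement on a punctured neighbourhood of every point. So
  both functions have the same pole or the same limit there, and normalisation determines the
  remaining value.\<close>

lemma nicely_meromorphic_on_UNIV_unique:
  assumes f: "f nicely_meromorphic_on UNIV" and h: "h nicely_meromorphic_on UNIV"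
    and V: "open V" "V \<noteq> {}" "\<And>z. z \<in> V \<Longrightarrow> f z = h z"
  shows "f = h"
proof -
  have mero: "(\<lambda>z. f z - h z) meromorphic_on UNIV"
    using f h by (intro meromorphic_intros) (auto simp: nicely_meromorphic_on_def)
  obtain a where a: "a \<in> V" using V by blast
  have "eventually (\<lambda>z. z \<in> V) (at a)"
    using V(1) a by (simp add: eventually_at_in_open')
  hence "eventually (\<lambda>z. f z - h z = 0) (at a)"
    by eventually_elim (simp add: V)
  hence "\<not> eventually (\<lambda>z. f z - h z \<noteq> 0) (at a)"
    using eventually_happens'[OF at_neq_bot eventually_conj] by fastforce
  hence "eventually (\<lambda>z. f z - h z = 0) (cosparse UNIV)"
    using meromorphic_imp_constant_or_avoid[OF mero open_UNIV connected_UNIV, of 0]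
    by (auto simp: eventually_cosparse_open_eq)
  hence ev: "eventually (\<lambda>w. f w = h w) (at z)" for z
    by (auto simp: eventually_cosparse_open_eq)
  show ?thesis
  proof
    fix z
    have pole: "is_pole f z \<longleftrightarrow> is_pole h z"
      by (intro is_pole_cong ev refl)
    have lim: "f \<midarrow>z\<rightarrow> c \<longleftrightarrow> h \<midarrow>z\<rightarrow> c" for c
      by (intro tendsto_cong ev)
    have "is_pole f z \<and> f z = 0 \<or> f \<midarrow>z\<rightarrow> f z" "is_pole h z \<and> h z = 0 \<or> h \<midarrow>z\<rightarrow> h z"
      using f h by (auto simp: nicely_meromorphic_on_def)
    thus "f z = h z"
      using pole lim not_tendsto_and_filterlim_at_infinity[OF at_neq_bot]
      unfolding is_pole_def by (metis LIM_unique)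
  qed
qed

text \<open>The weight that selects n1 = 1 turns the double sum into zeta(s2) - 1, for any s1. On
  the line s1 + s2 = 3 the factor \<open>rGamma (fst p + snd p - 2)\<close> equals 1, and adding s -
  1 restores the missing first term of zeta.\<close>

lemma zeta_continuation:
  obtains g where "g holomorphic_on UNIV" "g 1 = 1"
    "\<And>s. Re s > 1 \<Longrightarrow> g s = (s - 1) * (\<Sum>n. zeta_term n s)"
proof -
  define w :: "nat \<Rightarrow> complex" where "w = (\<lambda>n. if n = 0 then 1 else 0)"
  define E :: "complex \<times> complex \<Rightarrow> complex" where "E = (\<lambda>p. rGamma (fst p + snd p - 2))"
  have w1: "norm (w n) \<le> 1" for n by (simp add: w_def)
  have w_sum: "(\<Sum>n. w n * f n) = f 0" for f
    by (subst suminf_finite[of "{0}"]) (auto simp: w_def)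
  have hol: "holomorphic2_on E UNIV" unfolding E_def
    by (rule holomorphic2_on_compose1[OF holomorphic_rGamma[of UNIV]])
       (auto intro!: holomorphic2_intros)
  have E_eq: "E p = rGamma (fst p + snd p - 2) * (\<Sum>n. w n * of_nat (Suc n) powr (1 - fst p - snd p))" for p
    unfolding w_sum by (simp add: E_def)
  obtain G where G: "holomorphic2_on G UNIV"
    "\<And>p. p \<in> shifted_region 0 \<Longrightarrow>
       G p = (snd p - 1) * rGamma (fst p + snd p - 2) * weighted_dsum w zeta_term p"
    "\<And>s. G (s, 1) = E (s, 1)"
    using dsum_continuation[OF w1 hol E_eq] by blast
  show ?thesis
  proof (rule that[of "\<lambda>s. G (3 - s, s) + (s - 1)"])
    show "(\<lambda>s. G (3 - s, s) + (s - 1)) holomorphic_on UNIV"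
      by (intro holomorphic_intros holomorphic2_on_imp_holomorphic_on[OF G(1)]) auto
    \<comment> \<open>The residue appears as E (2, 1), which is the reciprocal Gamma function at
      1.\<close>
    show "G (3 - 1, 1) + (1 - 1) = 1"
      using G(3)[of 2] by (simp add: E_def)
    fix s :: complex assume s: "Re s > 1"
    have "weighted_dsum w zeta_term (3 - s, s) = (\<Sum>j. zeta_term (Suc j) s)"
      unfolding weighted_dsum_def mult.assoc w_sum by simp
    moreover have "(3 - s, s) \<in> shifted_region 0" using s by (simp add: shifted_region_def)
    ultimately have "G (3 - s, s) = (s - 1) * (\<Sum>j. zeta_term (Suc j) s)"
      using G(2) by simp
    moreover have "(\<Sum>n. zeta_term n s) = (\<Sum>j. zeta_term (Suc j) s) + 1"
      using suminf_split_head[of "\<lambda>n. zeta_term n s"] summable_zeta_tail[OF s, of 0]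
      by (simp add: zeta_term_def)
    ultimately show "G (3 - s, s) + (s - 1) = (s - 1) * (\<Sum>n. zeta_term n s)"
      by (simp add: algebra_simps)
  qed
qed

lemma riemann_zeta_eq:
  assumes g: "g holomorphic_on UNIV" "g 1 = 1"
    and g_eq: "\<And>s. Re s > 1 \<Longrightarrow> g s = (s - 1) * (\<Sum>n. zeta_term n s)"
  shows "riemann_zeta s = g s / (s - 1)"
proof -
  define f where "f = (\<lambda>s. g s / (s - 1))"
  have f_eq: "f s = (\<Sum>n. 1 / of_nat (Suc n) powr s)" if "Re s > 1" for s
  proof -
    have "s \<noteq> 1" using that by auto
    thus ?thesis using g_eq[OF that]
      by (simp add: f_def zeta_term_def powr_minus_divide del: of_nat_Suc)
  qed
  have "f meromorphic_on UNIV" unfolding f_def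
    by (intro meromorphic_intros analytic_on_imp_meromorphic_on)
       (use g in \<open>auto simp: analytic_on_open\<close>)
  moreover have "is_pole f z \<and> f z = 0 \<or> f \<midarrow>z\<rightarrow> f z" for z
  proof (cases "z = 1")
    \<comment> \<open>Since g 1 = 1, the point 1 is a genuine pole, and division by zero supplies
      the prescribed value 0.\<close>
    case True
    have "isCont g 1" using g(1)
      by (metis UNIV_I continuous_on_eq_continuous_at holomorphic_on_imp_continuous_on open_UNIV)
    moreover have "filterlim (\<lambda>s::complex. s - 1) (at 0) (at 1)"
      by (rule filterlim_atI) (auto intro!: tendsto_eq_intros simp: eventually_at_filter)
    ultimately have "is_pole f 1"
      unfolding f_def using g(2) by (intro is_pole_divide) auto
    thus ?thesis using True by (simp add: f_def)
  next
    case False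
    have "isCont g z" using g(1)
      by (metis UNIV_I continuous_on_eq_continuous_at holomorphic_on_imp_continuous_on open_UNIV)
    hence "isCont f z" unfolding f_def using False by (intro continuous_intros) auto
    thus ?thesis by (simp add: isCont_def)
  qed
  ultimately have nice: "f nicely_meromorphic_on UNIV"
    by (simp add: nicely_meromorphic_on_def)
  have "riemann_zeta = f" unfolding riemann_zeta_def
  proof (rule the_equality)
    show "f nicely_meromorphic_on UNIV \<and>
            (\<forall>s. 1 < Re s \<longrightarrow> f s = (\<Sum>n. 1 / of_nat (Suc n) powr s))"
      using nice f_eq by blast
    fix h assume h: "h nicely_meromorphic_on UNIV \<and>
            (\<forall>s. 1 < Re s \<longrightarrow> h s = (\<Sum>n. 1 / of_nat (Suc n) powr s))"
    show "h = f"
    proof (rule nicely_meromorphic_on_UNIV_unique[OF _ nice open_halfspace_Re_gt])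
      show "{s. Re s > 1} \<noteq> {}" by (auto intro!: exI[of _ 2])
    qed (use h f_eq in auto)
  qed
  thus ?thesis unfolding f_def by (rule fun_cong)
qed

section \<open>Meromorphic functions of two variables\<close>

lemma open_meets_dense:
  assumes "open Q" "Q \<noteq> {}" "Q \<subseteq> closure A"
  shows "Q \<inter> A \<noteq> {}"
  using assms open_Int_closure_eq_empty[of Q A] by blast

lemma subset_closure_iff_meets:
  assumes "open U"
  shows "U \<subseteq> closure {z \<in> U. P z} \<longleftrightarrow> (\<forall>Q. open Q \<and> Q \<noteq> {} \<and> Q \<subseteq> U \<longrightarrow> (\<exists>z\<in>Q. P z))"
proof
  assume "U \<subseteq> closure {z \<in> U. P z}"
  thus "\<forall>Q. open Q \<and> Q \<noteq> {} \<and> Q \<subseteq> U \<longrightarrow> (\<exists>z\<in>Q. P z)"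
    using open_meets_dense[of _ "{z \<in> U. P z}"] by blast
next
  assume *: "\<forall>Q. open Q \<and> Q \<noteq> {} \<and> Q \<subseteq> U \<longrightarrow> (\<exists>z\<in>Q. P z)"
  show "U \<subseteq> closure {z \<in> U. P z}"
  proof (rule ccontr)
    assume "\<not> ?thesis"
    moreover have "open (U - closure {z \<in> U. P z})" using assms by auto
    ultimately obtain z where "z \<in> U - closure {z \<in> U. P z}" "P z" using * by blast
    thus False using closure_subset[of "{z \<in> U. P z}"] by blast
  qed
qed

lemma dense_in_openD:
  assumes "U \<subseteq> closure {z \<in> U. P z}" "open U" "open Q" "q \<in> Q" "Q \<subseteq> U"
  obtains z where "z \<in> Q" "P z"
  using assms open_meets_dense[of Q "{z \<in> U. P z}"] by blast

lemma open_nonzero: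
  assumes "continuous_on U h" "open Q" "Q \<subseteq> U"
  shows "open {z \<in> Q. h z \<noteq> (0::complex)}"
proof -
  have "open (Q \<inter> h -` (- {0}))"
    using assms by (intro continuous_open_preimage continuous_on_subset[OF assms(1)]) auto
  also have "Q \<inter> h -` (- {0}) = {z \<in> Q. h z \<noteq> 0}" by auto
  finally show ?thesis .
qed

lemma eq_at_limit_of_dense_eq:
  fixes f g :: "complex \<times> complex \<Rightarrow> complex"
  assumes "continuous_on U f" "continuous_on U g" "open U" "p \<in> U"
    and dense: "U \<subseteq> closure {z \<in> U. f z = g z}"
  shows "f p = g p"
proof (rule ccontr)
  assume ne: "f p \<noteq> g p"
  define Q where "Q = {z \<in> U. f z - g z \<noteq> 0}"
  have "open Q" unfolding Q_def
    by (intro open_nonzero[of U] continuous_intros assms) simp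
  moreover have "p \<in> Q" "Q \<subseteq> U" using ne assms(4) by (auto simp: Q_def)
  ultimately obtain z where "z \<in> Q" "f z = g z"
    using dense_in_openD[OF dense \<open>open U\<close>] by metis
  thus False by (simp add: Q_def)
qed

lemma nonzero_dense:
  assumes F: "holomorphic2_on F U" and U: "open U" "convex U" and z: "z \<in> U" "F z \<noteq> 0"
  shows "U \<subseteq> closure {z \<in> U. F z \<noteq> 0}"
  unfolding subset_closure_iff_meets[OF U(1)]
  using holomorphic2_identity[OF F U _ _ _ _ z(1)] z(2) by blast

text \<open>The interior of the closure of the equality set is shown to be clopen. Only dense
  equality can be expected, because meromorphy leaves the values free where a local denominator
  vanishes.\<close>

lemma meromorphic2_dense_eq:
  assumes f: "meromorphic2 f" and f': "meromorphic2 f'"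
    and V: "open V" "V \<noteq> {}" "\<And>z. z \<in> V \<Longrightarrow> f z = f' z"
  shows "closure {z. f z = f' z} = UNIV"
proof -
  define W where "W = {z. f z = f' z}"
  define S where "S = interior (closure W)"
  have "V \<subseteq> S" unfolding S_def
    using V by (intro interior_maximal) (auto simp: W_def intro: closure_subset[THEN subsetD])
  hence "S \<noteq> {}" using V by blast
  have "p \<in> S" if p: "p \<in> closure S" for p
  proof -
    obtain U g h where U: "open U" "p \<in> U" "holomorphic2_on g U" "holomorphic2_on h U"
      "U \<subseteq> closure {z \<in> U. h z \<noteq> 0}" "\<forall>z\<in>U. h z \<noteq> 0 \<longrightarrow> f z = g z / h z"
      using f unfolding meromorphic2_def by meson
    obtain U' g' h' where U': "open U'" "p \<in> U'" "holomorphic2_on g' U'" "holomorphic2_on h' U'"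
      "U' \<subseteq> closure {z \<in> U'. h' z \<noteq> 0}" "\<forall>z\<in>U'. h' z \<noteq> 0 \<longrightarrow> f' z = g' z / h' z"
      using f' unfolding meromorphic2_def by meson
    have "open (U \<inter> U')" "p \<in> U \<inter> U'" using U U' by auto
    then obtain r where r: "r > 0" "ball p r \<subseteq> U \<inter> U'" using openE by blast
    define B where "B = ball p r"
    have B: "open B" "convex B" "p \<in> B" "B \<subseteq> U" "B \<subseteq> U'" using r by (auto simp: B_def)
    have cont: "continuous_on U h" "continuous_on U' h'"
      using U U' holomorphic2_on_imp_continuous_on by blast+
    \<comment> \<open>The non-vanishing sets of h and h' are open and dense, and so is their
      intersection.\<close>
    have nz: "\<exists>Q'. open Q' \<and> Q' \<noteq> {} \<and> Q' \<subseteq> Q \<and> (\<forall>z\<in>Q'. h z \<noteq> 0 \<and> h' z \<noteq> 0)"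
      if Q: "open Q" "Q \<noteq> {}" "Q \<subseteq> B" for Q
    proof -
      define Q1 where "Q1 = {z \<in> Q. h z \<noteq> 0}"
      have Q1: "open Q1" "Q1 \<subseteq> Q" unfolding Q1_def
        using open_nonzero[OF cont(1) Q(1)] Q B by auto
      have "Q1 \<noteq> {}"
        using U(5) Q B unfolding subset_closure_iff_meets[OF U(1)] Q1_def by blast
      define Q2 where "Q2 = {z \<in> Q1. h' z \<noteq> 0}"
      have "open Q2" unfolding Q2_def
        using open_nonzero[OF cont(2) Q1(1)] Q1 Q B by auto
      moreover have "Q2 \<noteq> {}"
      proof -
        have "Q1 \<subseteq> U'" using Q1 Q B by blast
        thus ?thesis
          using U'(5) Q1 \<open>Q1 \<noteq> {}\<close> unfolding subset_closure_iff_meets[OF U'(1)] Q2_def by blast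
      qed
      ultimately show ?thesis by (intro exI[of _ Q2]) (auto simp: Q2_def Q1_def)
    qed
    \<comment> \<open>The cross-multiplied difference of the two quotients is holomorphic on the
      whole ball. It vanishes on the part inside S, hence everywhere, which carries the equality
      across the boundary point p.\<close>
    define F where "F = (\<lambda>z. g z * h' z - g' z * h z)"
    have F: "holomorphic2_on F B" unfolding F_def
      using U U' B by (intro holomorphic2_intros) (auto intro: holomorphic2_on_subset)
    have "open S" by (simp add: S_def)
    have ne: "S \<inter> B \<noteq> {}"
      using p B \<open>open S\<close> by (metis IntI closure_iff_nhds_not_empty emptyE inf_commute subset_refl)
    have F0: "F q = 0" if q: "q \<in> S \<inter> B" for q
    proof (rule ccontr)
      assume "F q \<noteq> 0"
      define Q where "Q = {z \<in> S \<inter> B. F z \<noteq> 0}"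
      have "open Q" unfolding Q_def
        using \<open>open S\<close> B by (intro open_nonzero[OF holomorphic2_on_imp_continuous_on[OF F]]) auto
      moreover have "q \<in> Q" "Q \<subseteq> B" using q \<open>F q \<noteq> 0\<close> by (auto simp: Q_def)
      ultimately obtain Q' where Q': "open Q'" "Q' \<noteq> {}" "Q' \<subseteq> Q"
        "\<forall>z\<in>Q'. h z \<noteq> 0 \<and> h' z \<noteq> 0"
        using nz[of Q] by blast
      have "Q' \<subseteq> closure W"
        using Q'(3) interior_subset[of "closure W"] by (auto simp: Q_def S_def)
      then obtain z where z: "z \<in> Q'" "z \<in> W" using open_meets_dense[OF Q'(1,2)] by blast
      hence "z \<in> U" "z \<in> U'" "h z \<noteq> 0" "h' z \<noteq> 0" "F z \<noteq> 0" "f z = f' z"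
        using Q' B by (auto simp: Q_def W_def)
      moreover from this have "g z / h z = g' z / h' z" using U U' by simp
      ultimately show False by (simp add: F_def field_simps)
    qed
    have FB: "F z = 0" if "z \<in> B" for z
      by (rule holomorphic2_identity[OF F B(1,2) _ ne _ F0 that])
         (use B \<open>open S\<close> in auto)
    have "B \<subseteq> closure {z \<in> B. f z = f' z}"
      unfolding subset_closure_iff_meets[OF B(1)]
    proof (intro allI impI)
      fix Q assume "open Q \<and> Q \<noteq> {} \<and> Q \<subseteq> B"
      hence "open Q" "Q \<noteq> {}" "Q \<subseteq> B" by auto
      then obtain Q' where Q': "Q' \<noteq> {}" "Q' \<subseteq> Q" "\<forall>z\<in>Q'. h z \<noteq> 0 \<and> h' z \<noteq> 0"
        using nz by meson
      then obtain z where z: "z \<in> Q'" by blast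
      hence "z \<in> B" "z \<in> U" "z \<in> U'" "h z \<noteq> 0" "h' z \<noteq> 0" using Q' \<open>Q \<subseteq> B\<close> B by auto
      moreover from this have "F z = 0" using FB by blast
      moreover from calculation have "f z = g z / h z" "f' z = g' z / h' z" using U(6) U'(6) by auto
      ultimately have "f z = f' z" by (simp add: F_def frac_eq_eq)
      thus "\<exists>z\<in>Q. f z = f' z" using z Q' by blast
    qed
    also have "\<dots> \<subseteq> closure W" by (intro closure_mono) (auto simp: W_def)
    finally have "B \<subseteq> S" unfolding S_def using B by (intro interior_maximal)
    thus "p \<in> S" using B by blast
  qed
  hence "closed S" using closure_subset_eq by blast
  moreover have "open S" by (simp add: S_def)
  ultimately have "S = UNIV" using \<open>S \<noteq> {}\<close> clopen by blast
  thus ?thesis using interior_subset[of "closure W"] by (auto simp: S_def W_def)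
qed

section \<open>Normalised meromorphic functions: uniqueness and construction\<close>

lemma nicely_meromorphic2_removable:
  assumes f: "nicely_meromorphic2 f"
    and U: "open U" "p \<in> U" "holomorphic2_on g U" "U \<subseteq> closure {z \<in> U. f z = g z}"
  shows "holomorphic2_at f p"
proof -
  have "if \<exists>U g. open U \<and> p \<in> U \<and> holomorphic2_on g U \<and> U \<subseteq> closure {z \<in> U. f z = g z}
        then holomorphic2_at f p else f p = 0"
    using f unfolding nicely_meromorphic2_def by (elim conjE) (erule spec)
  moreover have "\<exists>U g. open U \<and> p \<in> U \<and> holomorphic2_on g U \<and> U \<subseteq> closure {z \<in> U. f z = g z}"
    by (intro exI[of _ U] exI[of _ g] conjI U)
  ultimately show ?thesis by (simp only: if_True)
qed

lemma nicely_meromorphic2_singular: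
  assumes f: "nicely_meromorphic2 f" and sing: "\<not> holomorphic2_at f p"
  shows "f p = 0"
proof -
  have "if \<exists>U g. open U \<and> p \<in> U \<and> holomorphic2_on g U \<and> U \<subseteq> closure {z \<in> U. f z = g z}
        then holomorphic2_at f p else f p = 0"
    using f unfolding nicely_meromorphic2_def by (elim conjE) (erule spec)
  thus ?thesis using sing by (simp only: split: if_splits)
qed

text \<open>Near a regular point of one function, that function is a holomorphic extension agreeing
  densely with the other, so both have the same regular points. Continuity gives equality there, and
  elsewhere both values are 0.\<close>

lemma nicely_meromorphic2_unique:
  assumes f: "nicely_meromorphic2 f" and f': "nicely_meromorphic2 f'"
    and V: "open V" "V \<noteq> {}" "\<And>z. z \<in> V \<Longrightarrow> f z = f' z"
  shows "f = f'"
proof -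
  have dense: "closure {z. f z = f' z} = UNIV"
    using f f' V by (intro meromorphic2_dense_eq) (auto simp: nicely_meromorphic2_def)
  have denseU: "U \<subseteq> closure {z \<in> U. f z = f' z}" if "open U" for U
    unfolding subset_closure_iff_meets[OF that] using open_meets_dense[of _ "{z. f z = f' z}"] dense
    by blast
  have denseU': "U \<subseteq> closure {z \<in> U. f' z = f z}" if "open U" for U
    using denseU[OF that] by (simp add: eq_commute)
  have transfer: "holomorphic2_at h' p"
    if h: "holomorphic2_at h p" and h': "nicely_meromorphic2 h'"
      and d: "\<And>U. open U \<Longrightarrow> U \<subseteq> closure {z \<in> U. h' z = h z}" for h h' p
  proof -
    obtain U where "open U" "p \<in> U" "holomorphic2_on h U"
      using h unfolding holomorphic2_at_def by blast
    with d[of U] show ?thesis by (intro nicely_meromorphic2_removable[OF h'])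
  qed
  show ?thesis
  proof
    fix p
    show "f p = f' p"
    proof (cases "holomorphic2_at f p")
      case True
      obtain U where U: "open U" "p \<in> U" "holomorphic2_on f U"
        using True unfolding holomorphic2_at_def by blast
      obtain U' where U': "open U'" "p \<in> U'" "holomorphic2_on f' U'"
        using transfer[OF True f' denseU'] unfolding holomorphic2_at_def by blast
      have "open (U \<inter> U')" "p \<in> U \<inter> U'" using U U' by auto
      moreover have "continuous_on (U \<inter> U') f" "continuous_on (U \<inter> U') f'"
        using U U' by (auto intro: continuous_on_subset holomorphic2_on_imp_continuous_on)
      ultimately show ?thesis
        by (intro eq_at_limit_of_dense_eq[of "U \<inter> U'"] denseU)
    next
      case False
      hence "\<not> holomorphic2_at f' p" using transfer[OF _ f denseU] by blast
      thus ?thesis using False nicely_meromorphic2_singular f f' by metis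
    qed
  qed
qed

text \<open>The value at p is that of any holomorphic extension of G / H to a neighbourhood of p,
  and 0 if there is none. Density of the set H \<noteq> 0 makes the value independent of the
  extension.\<close>

lemma nicely_meromorphic2_quotient:
  assumes G: "holomorphic2_on G UNIV" and H: "holomorphic2_on H UNIV" and nz: "H a \<noteq> 0"
  obtains f where "nicely_meromorphic2 f" "\<And>p. H p \<noteq> 0 \<Longrightarrow> f p = G p / H p"
    "\<And>p. H p \<noteq> 0 \<Longrightarrow> holomorphic2_at f p"
proof -
  define ext where "ext = (\<lambda>U g. open U \<and> holomorphic2_on g U \<and> (\<forall>z\<in>U. H z \<noteq> 0 \<longrightarrow> g z = G z / H z))"
  define f where "f = (\<lambda>p. if \<exists>U g. p \<in> U \<and> ext U g then SOME v. \<exists>U g. p \<in> U \<and> ext U g \<and> v = g p else 0)"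
  have contH: "continuous_on UNIV H" using H by (rule holomorphic2_on_imp_continuous_on)
  have dense: "U \<subseteq> closure {z \<in> U. H z \<noteq> 0}" if "open U" for U
  proof -
    have "UNIV \<subseteq> closure {z \<in> UNIV. H z \<noteq> 0}"
      by (rule nonzero_dense[OF H open_UNIV convex_UNIV UNIV_I nz])
    thus ?thesis
      unfolding subset_closure_iff_meets[OF that] subset_closure_iff_meets[OF open_UNIV] by blast
  qed
  have ext_unique: "g p = g' p" if "ext U g" "ext U' g'" "p \<in> U" "p \<in> U'" for U U' g g' p
  proof (rule eq_at_limit_of_dense_eq[of "U \<inter> U'"])
    have "U \<inter> U' \<subseteq> closure {z \<in> U \<inter> U'. H z \<noteq> 0}"
      using that by (intro dense) (auto simp: ext_def)
    also have "\<dots> \<subseteq> closure {z \<in> U \<inter> U'. g z = g' z}"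
      using that by (intro closure_mono) (auto simp: ext_def)
    finally show "U \<inter> U' \<subseteq> closure {z \<in> U \<inter> U'. g z = g' z}" .
  qed (use that in \<open>auto simp: ext_def intro: continuous_on_subset holomorphic2_on_imp_continuous_on\<close>)
  have f_ext: "f p = g p" if "ext U g" "p \<in> U" for U g p
  proof -
    have ex: "\<exists>U g. p \<in> U \<and> ext U g" using that by blast
    hence "\<exists>v. \<exists>U g. p \<in> U \<and> ext U g \<and> v = g p" by blast
    from someI_ex[OF this] obtain U' g' where "p \<in> U'" "ext U' g'" "f p = g' p"
      using ex by (auto simp: f_def)
    thus ?thesis using ext_unique that by metis
  qed
  have f_hol: "holomorphic2_at f p" if e: "ext U g" "p \<in> U" for U g p
  proof -
    have "holomorphic2_on f U"
      using holomorphic2_on_cong[of g U f] f_ext[OF e(1)] e(1) by (auto simp: ext_def)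
    thus ?thesis using e unfolding holomorphic2_at_def ext_def by blast
  qed
  have ext0: "ext {p. H p \<noteq> 0} (\<lambda>p. G p / H p)"
    unfolding ext_def
  proof (intro conjI)
    show "open {p. H p \<noteq> 0}" using open_nonzero[OF contH open_UNIV] by simp
    show "holomorphic2_on (\<lambda>p. G p / H p) {p. H p \<noteq> 0}"
      by (intro holomorphic2_on_divide holomorphic2_on_subset[OF G] holomorphic2_on_subset[OF H]) auto
  qed simp
  have f_eq: "f p = G p / H p" if "H p \<noteq> 0" for p
    using f_ext[OF ext0] that by simp
  have mero: "meromorphic2 f"
    unfolding meromorphic2_def
  proof
    fix p
    show "\<exists>U g h. open U \<and> p \<in> U \<and> holomorphic2_on g U \<and> holomorphic2_on h U \<and>
        U \<subseteq> closure {z \<in> U. h z \<noteq> 0} \<and> (\<forall>z\<in>U. h z \<noteq> 0 \<longrightarrow> f z = g z / h z)"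
      using G H dense[OF open_UNIV] f_eq
      by (rule_tac exI[of _ UNIV], rule_tac exI[of _ G], rule_tac exI[of _ H]) simp
  qed
  have sing: "if \<exists>U g. open U \<and> p \<in> U \<and> holomorphic2_on g U \<and> U \<subseteq> closure {z \<in> U. f z = g z}
          then holomorphic2_at f p else f p = 0" for p
  proof (cases "\<exists>U g. open U \<and> p \<in> U \<and> holomorphic2_on g U \<and> U \<subseteq> closure {z \<in> U. f z = g z}")
    case True
    then obtain U g where U: "open U" "p \<in> U" "holomorphic2_on g U" "U \<subseteq> closure {z \<in> U. f z = g z}"
      by blast
    \<comment> \<open>The given g agrees with f only densely; off the zeros of H both are
      continuous, so they agree everywhere there and g is an extension of the quotient.\<close>
    define Q where "Q = {z \<in> U. H z \<noteq> 0}"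
    have oQ: "open Q" unfolding Q_def using open_nonzero[OF contH U(1)] by simp
    have "g z = f z" if z: "z \<in> Q" for z
    proof -
      have "holomorphic2_on f Q"
        by (rule holomorphic2_on_cong[OF holomorphic2_on_divide[of G Q H] oQ])
           (use G H f_eq in \<open>auto simp: Q_def intro: holomorphic2_on_subset\<close>)
      moreover have "Q \<subseteq> closure {z \<in> Q. g z = f z}"
        using U(4) unfolding subset_closure_iff_meets[OF oQ] subset_closure_iff_meets[OF U(1)]
        by (metis (no_types, lifting) Q_def mem_Collect_eq subset_iff)
      ultimately show ?thesis
        using z oQ U(3) by (intro eq_at_limit_of_dense_eq[of Q])
          (auto simp: Q_def intro: holomorphic2_on_imp_continuous_on continuous_on_subset)
    qed
    hence "ext U g" using U f_eq by (auto simp: ext_def Q_def)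
    thus ?thesis using f_hol U True by auto
  next
    case False
    have "f p = 0"
    proof (rule ccontr)
      assume "f p \<noteq> 0"
      then obtain U g where e: "p \<in> U" "ext U g" by (auto simp: f_def split: if_splits)
      have "{z \<in> U. f z = g z} = U" using f_ext[OF e(2)] by auto
      hence "open U \<and> p \<in> U \<and> holomorphic2_on g U \<and> U \<subseteq> closure {z \<in> U. f z = g z}"
        using e closure_subset by (auto simp: ext_def)
      thus False using False by blast
    qed
    thus ?thesis unfolding if_not_P[OF False] .
  qed
  have "nicely_meromorphic2 f"
    unfolding nicely_meromorphic2_def by (rule conjI[OF mero]) (rule allI, rule sing)
  thus ?thesis using that f_eq f_hol[OF ext0] by blast
qed

section \<open>The Euler double zeta function\<close>

lemma infsum_nat_eq_suminf:
  fixes f :: "nat \<Rightarrow> 'a::{comm_monoid_add, t2_space}"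
  assumes "f summable_on UNIV"
  shows "infsum f UNIV = suminf f"
  using has_sum_imp_sums[OF has_sum_infsum[OF assms]] by (rule sums_unique)

text \<open>The family is dominated by the product \<beta> n \<beta> j of two summable sequences.
  This absolute summability justifies passing from the unordered sum to the iterated series.\<close>

lemma double_zeta_series:
  assumes s: "Re s1 + Re s2 > 2" "Re s2 > 1"
  shows "(\<Sum>\<^sub>\<infinity>(n1, n2)\<in>{1::nat..} \<times> {1::nat..}. 1 / (of_nat n1 powr s1 * of_nat (n1 + n2) powr s2)) =
         weighted_dsum (\<lambda>_. 1) zeta_term (s1, s2)"
proof -
  define t where "t = (\<lambda>(n, j). of_nat (Suc n) powr (- s1) * zeta_term (Suc n + j) s2)"
  define \<mu> where "\<mu> = min (Re s2 - 1) (Re s1 + Re s2 - 2)"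
  have \<mu>: "\<mu> > 0" "\<mu> \<le> Re s2 - 1" "\<mu> \<le> Re s1 + Re s2 - 2" using s by (auto simp: \<mu>_def)
  \<comment> \<open>Summing over j takes 1 + \<delta> of the total exponent and leaves at least 1 +
    \<delta> for n.\<close>
  define \<delta> where "\<delta> = \<mu> / 2"
  have \<delta>: "\<delta> > 0" "Re s2 \<ge> 1 + \<delta>" "Re s1 + Re s2 \<ge> 2 + 2 * \<delta>" using \<mu> by (simp_all add: \<delta>_def)
  define \<beta> where "\<beta> = (\<lambda>n. real (Suc n) powr (-1-\<delta>))"
  have \<beta>_nonneg: "\<beta> n \<ge> 0" for n by (simp add: \<beta>_def)
  have "summable \<beta>" unfolding \<beta>_def by (rule summable_Suc_powr[OF \<delta>(1)])
  hence \<beta>_on: "\<beta> summable_on UNIV"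
    using \<beta>_nonneg by (intro norm_summable_imp_summable_on) simp
  have t_le: "norm (t (n, j)) \<le> \<beta> n * \<beta> j" for n j
  proof -
    have z: "norm (zeta_term (Suc n + j) s2) \<le> 1 * real (Suc n + Suc j) powr (- Re s2)" for j
      by (simp add: zeta_term_def norm_of_nat_powr del: of_nat_Suc of_nat_add)
    have "norm (t (n, j)) = real (Suc n) powr (- Re s1) * norm (zeta_term (Suc n + j) s2)"
      by (simp add: t_def norm_mult norm_of_nat_powr del: of_nat_Suc)
    also have "\<dots> \<le> real (Suc n) powr (- Re s1) *
                  (1 * real (Suc n) powr (1 + \<delta> - Re s2) * real (Suc j) powr (-1-\<delta>))"
      by (intro mult_left_mono powr_tail_bound(1)[OF z \<delta>(1,2)]) auto
    also have "\<dots> = real (Suc n) powr (1 + \<delta> - (Re s1 + Re s2)) * \<beta> j"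
      by (simp add: \<beta>_def powr_add[symmetric] algebra_simps)
    also have "\<dots> \<le> \<beta> n * \<beta> j"
      unfolding \<beta>_def using \<delta> by (intro mult_right_mono powr_mono) auto
    finally show ?thesis .
  qed
  have "(\<lambda>x. norm (case x of (n, j) \<Rightarrow> \<beta> n * \<beta> j)) summable_on UNIV \<times> UNIV"
    unfolding Infinite_Sum.abs_summable_on_Sigma_iff
    using \<beta>_on \<beta>_nonneg
    by (auto simp: abs_mult infsum_cmult_right' infsum_nonneg
        intro!: summable_on_cmult_right summable_on_cmult_left)
  hence "(\<lambda>x. norm (t x)) summable_on UNIV \<times> UNIV"
  proof (rule Infinite_Sum.abs_summable_on_comparison_test)
    fix x :: "nat \<times> nat"
    show "norm (t x) \<le> norm (case x of (n, j) \<Rightarrow> \<beta> n * \<beta> j)"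
      using t_le \<beta>_nonneg by (cases x) auto
  qed
  hence t_sum: "t summable_on UNIV \<times> UNIV" by (rule Infinite_Sum.abs_summable_summable)
  have bij: "bij_betw (\<lambda>(n, j). (Suc n, Suc j)) (UNIV \<times> UNIV) ({1::nat..} \<times> {1::nat..})"
    by (rule bij_betwI[where g = "\<lambda>(n, j). (n - 1, j - 1)"]) auto
  have "(\<Sum>\<^sub>\<infinity>(n1, n2)\<in>{1::nat..} \<times> {1::nat..}. 1 / (of_nat n1 powr s1 * of_nat (n1 + n2) powr s2)) =
        (\<Sum>\<^sub>\<infinity>x\<in>UNIV \<times> UNIV. t x)"
    unfolding infsum_reindex_bij_betw[OF bij, symmetric]
    by (intro infsum_cong)
       (auto simp: t_def zeta_term_def powr_minus field_simps simp del: of_nat_Suc of_nat_add)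
  also have "\<dots> = (\<Sum>\<^sub>\<infinity>n. \<Sum>\<^sub>\<infinity>j. t (n, j))"
    using infsum_Sigma'_banach[of "\<lambda>n j. t (n, j)" UNIV "\<lambda>_. UNIV"] t_sum by simp
  also have "\<dots> = (\<Sum>n. \<Sum>\<^sub>\<infinity>j. t (n, j))"
    using summable_on_Sigma_banach[of "\<lambda>n j. t (n, j)" UNIV "\<lambda>_. UNIV"] t_sum
    by (intro infsum_nat_eq_suminf) simp
  also have "\<dots> = (\<Sum>n. of_nat (Suc n) powr (- s1) * (\<Sum>j. zeta_term (Suc n + j) s2))"
  proof (rule suminf_cong)
    fix n
    have "(\<lambda>j. t (n, j)) summable_on UNIV"
      using summable_on_SigmaD1[of "\<lambda>n j. t (n, j)" UNIV "\<lambda>_. UNIV"] t_sum by simp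
    hence "(\<Sum>\<^sub>\<infinity>j. t (n, j)) = (\<Sum>j. t (n, j))" by (rule infsum_nat_eq_suminf)
    also have "\<dots> = of_nat (Suc n) powr (- s1) * (\<Sum>j. zeta_term (Suc n + j) s2)"
      unfolding t_def using summable_zeta_tail[OF s(2), of "Suc n"] by (simp add: suminf_mult)
    finally show "(\<Sum>\<^sub>\<infinity>j. t (n, j)) = of_nat (Suc n) powr (- s1) * (\<Sum>j. zeta_term (Suc n + j) s2)" .
  qed
  also have "\<dots> = weighted_dsum (\<lambda>_. 1) zeta_term (s1, s2)"
    by (simp add: weighted_dsum_def)
  finally show ?thesis .
qed

text \<open>Its zeros are the lines s2 = 1 and s1 + s2 = 2, 1, 0, -1, ..., which contain all
  singularities of zeta_2.\<close>

definition polar_factor :: "complex \<times> complex \<Rightarrow> complex" where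
  "polar_factor p = (snd p - 1) * rGamma (fst p + snd p - 2)"

lemma polar_factor_nonzero:
  assumes "Re (fst p) + Re (snd p) > 2" "snd p \<noteq> 1"
  shows "polar_factor p \<noteq> 0"
proof -
  have "fst p + snd p - 2 \<notin> \<int>\<^sub>\<le>\<^sub>0"
  proof
    assume "fst p + snd p - 2 \<in> \<int>\<^sub>\<le>\<^sub>0"
    then obtain n where "fst p + snd p - 2 = - of_nat n" by (rule nonpos_Ints_cases')
    hence "Re (fst p + snd p - 2) = - real n" by simp
    thus False using assms by simp
  qed
  thus ?thesis using assms by (simp add: polar_factor_def rGamma_eq_zero_iff)
qed

lemma holomorphic2_polar_factor: "holomorphic2_on polar_factor U"
proof -
  have "holomorphic2_on (\<lambda>p. rGamma (fst p + snd p - 2)) U"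
    by (rule holomorphic2_on_compose1[OF holomorphic_rGamma[of UNIV]])
       (auto intro!: holomorphic2_intros)
  thus ?thesis unfolding polar_factor_def[abs_def] by (intro holomorphic2_intros)
qed

lemma euler_double_zeta_continuation:
  obtains G where "holomorphic2_on G UNIV"
    "\<And>p. p \<in> shifted_region 0 \<Longrightarrow> G p = polar_factor p * weighted_dsum (\<lambda>_. 1) zeta_term p"
    "\<And>p. polar_factor p \<noteq> 0 \<Longrightarrow> euler_double_zeta p = G p / polar_factor p"
    "\<And>p. polar_factor p \<noteq> 0 \<Longrightarrow> holomorphic2_at euler_double_zeta p"
proof -
  obtain g where g: "g holomorphic_on UNIV" "\<And>s. Re s > 1 \<Longrightarrow> g s = (s - 1) * (\<Sum>n. zeta_term n s)"
    using zeta_continuation by metis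
  \<comment> \<open>For u = s1 + s2 - 1 this is rGamma(u - 1) zeta(u) with the pole of zeta removed,
    because (u - 1) rGamma(u) = rGamma(u - 1).\<close>
  define E where "E = (\<lambda>p::complex \<times> complex. rGamma (fst p + snd p - 1) * g (fst p + snd p - 1))"
  have "(\<lambda>s. rGamma s * g s) holomorphic_on UNIV"
    using g by (intro holomorphic_intros)
  hence E: "holomorphic2_on E UNIV"
    unfolding E_def by (rule holomorphic2_on_compose1) (auto intro!: holomorphic2_intros)
  have E_eq: "E p = rGamma (fst p + snd p - 2) *
                 (\<Sum>n. 1 * of_nat (Suc n) powr (1 - fst p - snd p))" if "p \<in> shifted_region 0" for p
  proof -
    define u where "u = fst p + snd p - 1"
    have "Re u > 1" using that by (simp add: u_def shifted_region_def)
    hence "E p = ((u - 1) * rGamma u) * (\<Sum>n. zeta_term n u)"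
      using g(2)[of u] by (simp add: E_def u_def[symmetric])
    also have "(u - 1) * rGamma u = rGamma (u - 1)" using rGamma_plus1[of "u - 1"] by simp
    also have "(\<Sum>n. zeta_term n u) = (\<Sum>n. 1 * of_nat (Suc n) powr (1 - fst p - snd p))"
      by (simp add: zeta_term_def u_def algebra_simps del: of_nat_Suc)
    finally show ?thesis by (simp add: u_def)
  qed
  have one: "norm ((\<lambda>_::nat. 1 :: complex) n) \<le> 1" for n by simp
  obtain G where G: "holomorphic2_on G UNIV"
    "\<forall>p\<in>shifted_region 0.
       G p = (snd p - 1) * rGamma (fst p + snd p - 2) * weighted_dsum (\<lambda>_. 1) zeta_term p"
    using dsum_continuation[OF one E E_eq] by blast
  hence G_eq: "G p = polar_factor p * weighted_dsum (\<lambda>_. 1) zeta_term p"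
    if "p \<in> shifted_region 0" for p
    using that by (simp add: polar_factor_def)
  have "polar_factor (2, 2) \<noteq> 0" by (rule polar_factor_nonzero) auto
  from nicely_meromorphic2_quotient[OF G(1) holomorphic2_polar_factor this]
  obtain f where f: "nicely_meromorphic2 f"
    "\<And>p. polar_factor p \<noteq> 0 \<Longrightarrow> f p = G p / polar_factor p"
    "\<And>p. polar_factor p \<noteq> 0 \<Longrightarrow> holomorphic2_at f p" by blast
  let ?S = "\<lambda>s1 s2. \<Sum>\<^sub>\<infinity>(n1, n2)\<in>{1::nat..} \<times> {1::nat..}. 1 / (of_nat n1 powr s1 * of_nat (n1 + n2) powr s2)"
  have f_series: "f (s1, s2) = ?S s1 s2" if s: "Re s1 + Re s2 > 2" "Re s2 > 1" for s1 s2
  proof -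
    have "(s1, s2) \<in> shifted_region 0" using s by (simp add: shifted_region_def)
    moreover have "polar_factor (s1, s2) \<noteq> 0"
      using s by (intro polar_factor_nonzero) auto
    ultimately show ?thesis
      unfolding double_zeta_series[OF s] by (simp add: f(2) G_eq)
  qed
  have "euler_double_zeta = f"
    unfolding euler_double_zeta_def
  proof (rule the_equality)
    show "nicely_meromorphic2 f \<and>
      (\<forall>s1 s2. Re s1 + Re s2 > 2 \<and> Re s2 > 1 \<longrightarrow> f (s1, s2) = ?S s1 s2)"
      using f(1) f_series by blast
    fix h assume h: "nicely_meromorphic2 h \<and>
      (\<forall>s1 s2. Re s1 + Re s2 > 2 \<and> Re s2 > 1 \<longrightarrow> h (s1, s2) = ?S s1 s2)"
    show "h = f"
    proof (rule nicely_meromorphic2_unique[OF _ f(1) open_shifted_region[of 0]])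
      have "(2, 2) \<in> shifted_region 0" by (simp add: shifted_region_def)
      thus "shifted_region 0 \<noteq> {}" by blast
      show "h p = f p" if "p \<in> shifted_region 0" for p
      proof -
        have p: "Re (fst p) + Re (snd p) > 2" "Re (snd p) > 1"
          using that by (simp_all add: shifted_region_def)
        have "h (fst p, snd p) = ?S (fst p) (snd p)" using h p by blast
        thus ?thesis using f_series[OF p] by simp
      qed
      show "nicely_meromorphic2 h" using h by (rule conjunct1)
    qed
  qed
  note eq = this
  show ?thesis
    by (rule that[OF G(1) G_eq]) (simp_all add: eq f(2,3))
qed

text \<open>A crude polynomial bound, valid for every s in the disc; the factor n^(-s1) with large
  Re s1 outweighs it.\<close>

lemma norm_sum_zeta_term_le:
  assumes "norm s \<le> B"
  shows "norm (\<Sum>m<n. zeta_term m s) \<le> real n powr (1 + B)"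
proof (cases "n = 0")
  case False
  have "norm (\<Sum>m<n. zeta_term m s) \<le> (\<Sum>m<n. real n powr B)"
  proof (rule sum_norm_le)
    fix m assume m: "m \<in> {..<n}"
    have B: "- Re s \<le> B" "B \<ge> 0" using assms abs_Re_le_cmod[of s] by auto
    have "norm (zeta_term m s) = real (Suc m) powr (- Re s)"
      by (simp add: zeta_term_def norm_of_nat_powr del: of_nat_Suc)
    also have "\<dots> \<le> real (Suc m) powr B" using B by (intro powr_mono) auto
    also have "\<dots> \<le> real n powr B" using m B by (intro powr_mono2) auto
    finally show "norm (zeta_term m s) \<le> real n powr B" .
  qed
  also have "\<dots> = real n powr (1 + B)" using False by (simp add: powr_add)
  finally show ?thesis .
qed simp

text \<open>
  For large \<open>Re s\<^sub>1\<close> the outer sum converges without any restriction on \<open>s\<^sub>2\<close> once the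
  tails \<open>\<Sum>m>n. m\<^bsup>-s\<^sub>2\<^esup>\<close> are rewritten as \<open>\<zeta>(s\<^sub>2) - (\<Sum>m\<le>n. m\<^bsup>-s\<^sub>2\<^esup>)\<close>; its first
  term is \<open>\<zeta>(s\<^sub>2) - 1\<close> and the others decay exponentially.
\<close>

lemma euler_double_zeta_asymptotics:
  assumes g: "g holomorphic_on UNIV"
    and g_eq: "\<And>s. Re s > 1 \<Longrightarrow> g s = (s - 1) * (\<Sum>n. zeta_term n s)"
    and B: "B > 1"
  defines "\<Omega> \<equiv> {p. Re (fst p) > B + 3 \<and> norm (snd p) < B}"
  obtains F C where "holomorphic2_on F \<Omega>"
    "\<And>p. p \<in> \<Omega> \<Longrightarrow> norm (F p - (g (snd p) - (snd p - 1))) \<le> C * 2 powr (- Re (fst p))"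
    "\<And>p. p \<in> \<Omega> \<Longrightarrow> snd p \<noteq> 1 \<Longrightarrow> F p = (snd p - 1) * euler_double_zeta p"
    "\<And>p. p \<in> \<Omega> \<Longrightarrow> snd p \<noteq> 1 \<Longrightarrow> holomorphic2_at euler_double_zeta p"
proof -
  obtain G where G: "holomorphic2_on G UNIV"
    "\<And>p. p \<in> shifted_region 0 \<Longrightarrow> G p = polar_factor p * weighted_dsum (\<lambda>_. 1) zeta_term p"
    "\<And>p. polar_factor p \<noteq> 0 \<Longrightarrow> euler_double_zeta p = G p / polar_factor p"
    "\<And>p. polar_factor p \<noteq> 0 \<Longrightarrow> holomorphic2_at euler_double_zeta p"
    using euler_double_zeta_continuation by metis
  \<comment> \<open>The factor s2 - 1 is kept inside the terms, so that they are holomorphic at s2 =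
    1 as well.\<close>
  define L where "L = (\<lambda>n p. of_nat (Suc n) powr (- fst p) *
     (g (snd p) - (snd p - 1) * (\<Sum>m<Suc n. zeta_term m (snd p))))"
  define F where "F = (\<lambda>p. \<Sum>n. L n p)"
  have "compact (g ` cball 0 B)"
    using g by (intro compact_continuous_image holomorphic_on_imp_continuous_on)
               (auto intro: holomorphic_on_subset)
  hence "bounded (g ` cball 0 B)" by (rule compact_imp_bounded)
  then obtain M where "M > 0" "\<forall>x\<in>g ` cball 0 B. norm x \<le> M"
    unfolding bounded_pos by blast
  hence M: "M > 0" "\<And>s. norm s \<le> B \<Longrightarrow> norm (g s) \<le> M" by auto
  define A where "A = M + (B + 1)"
  have L_le: "norm (L n p) \<le> A * real (Suc n) powr (1 + B - Re (fst p))" if p: "p \<in> \<Omega>" for n p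
  proof -
    have nB: "norm (snd p) \<le> B" using p by (simp add: \<Omega>_def)
    have ge1: "real (Suc n) powr (1 + B) \<ge> 1" using B by (intro ge_one_powr_ge_zero) auto
    have "norm (g (snd p) - (snd p - 1) * (\<Sum>m<Suc n. zeta_term m (snd p))) \<le>
          norm (g (snd p)) + norm (snd p - 1) * norm (\<Sum>m<Suc n. zeta_term m (snd p))"
      by (metis norm_mult norm_triangle_ineq4)
    also have "\<dots> \<le> M * real (Suc n) powr (1 + B) + (B + 1) * real (Suc n) powr (1 + B)"
    proof (intro add_mono mult_mono norm_sum_zeta_term_le nB)
      show "norm (g (snd p)) \<le> M * real (Suc n) powr (1 + B)"
        using M(2)[OF nB] mult_left_mono[OF ge1, of M] M(1) by linarith
      show "norm (snd p - 1) \<le> B + 1" using norm_triangle_ineq4[of "snd p" 1] nB by simp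
    qed (use B in auto)
    also have "\<dots> = A * real (Suc n) powr (1 + B)" by (simp add: A_def distrib_right)
    finally have "norm (L n p) \<le> real (Suc n) powr (- Re (fst p)) * (A * real (Suc n) powr (1 + B))"
      unfolding L_def norm_mult by (subst norm_of_nat_powr) (auto intro!: mult_left_mono)
    thus ?thesis by (simp add: powr_add[symmetric] algebra_simps)
  qed
  have A: "A > 0" using M B by (simp add: A_def)
  have sm2: "summable (\<lambda>n. real (Suc n) powr (-2))"
    using summable_Suc_powr[of 1] by simp
  have L_le2: "norm (L n p) \<le> A * real (Suc n) powr (-2)" if p: "p \<in> \<Omega>" for n p
  proof -
    \<comment> \<open>This is where Re s1 > B + 3 enters: the exponent drops below -2.\<close>
    have "real (Suc n) powr (1 + B - Re (fst p)) \<le> real (Suc n) powr (-2)"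
      using p by (intro powr_mono) (auto simp: \<Omega>_def)
    thus ?thesis using L_le[OF p, of n] A by (meson less_imp_le mult_left_mono order_trans)
  qed
  have open\<Omega>: "open \<Omega>" unfolding \<Omega>_def
    by (intro open_Collect_conj open_Collect_less continuous_intros)
  have convex\<Omega>: "convex \<Omega>"
  proof -
    have "\<Omega> = (\<lambda>p. Re (fst p)) -` {B + 3<..} \<inter> snd -` ball 0 B" by (auto simp: \<Omega>_def)
    thus ?thesis
      by (auto intro!: convex_Int convex_linear_vimage linearI simp: algebra_simps)
  qed
  have hL: "holomorphic2_on (L n) \<Omega>" for n
  proof -
    have h1: "(\<lambda>s. of_nat (Suc n) powr (- s) :: complex) holomorphic_on UNIV"
      by (intro holomorphic_intros) (simp del: of_nat_Suc)
    have h2: "(\<lambda>s. g s - (s - 1) * (\<Sum>m<Suc n. zeta_term m s)) holomorphic_on UNIV"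
      by (intro holomorphic_intros g holomorphic_zeta_term)
    show ?thesis unfolding L_def
      by (intro holomorphic2_on_mult holomorphic2_on_compose1[OF h1] holomorphic2_on_compose1[OF h2]
            holomorphic2_on_fst holomorphic2_on_snd) auto
  qed
  have hF: "holomorphic2_on F \<Omega>" unfolding F_def
  proof (rule holomorphic2_on_suminf[OF hL])
    fix p assume "p \<in> \<Omega>"
    thus "\<exists>V M. open V \<and> p \<in> V \<and> V \<subseteq> \<Omega> \<and> summable M \<and> (\<forall>n. \<forall>q\<in>V. norm (L n q) \<le> M n)"
      using open\<Omega> L_le2 summable_mult[OF sm2, of A]
      by (intro exI[of _ \<Omega>] exI[of _ "\<lambda>n. A * real (Suc n) powr (-2)"]) auto
  qed
  have F_series: "F p = (snd p - 1) * weighted_dsum (\<lambda>_. 1) zeta_term p"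
    if p: "p \<in> \<Omega>" "Re (snd p) > 1" for p
  proof -
    have p0: "p \<in> shifted_region 0" using p B by (auto simp: \<Omega>_def shifted_region_def)
    have tail: "L n p = (snd p - 1) * (1 * of_nat (Suc n) powr (- fst p) * (\<Sum>j. zeta_term (Suc n + j) (snd p)))" for n
    proof -
      have "(\<Sum>m. zeta_term m (snd p)) =
              (\<Sum>j. zeta_term (j + Suc n) (snd p)) + (\<Sum>m<Suc n. zeta_term m (snd p))"
        using summable_zeta_tail[OF p(2), of 0] by (intro suminf_split_initial_segment) simp
      thus ?thesis
        unfolding L_def g_eq[OF p(2)] by (simp add: algebra_simps del: sum.lessThan_Suc)
    qed
    have "summable (\<lambda>n. 1 * of_nat (Suc n) powr (- fst p) * (\<Sum>j. zeta_term (Suc n + j) (snd p)))"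
      by (rule zeta_term_dsum(2)) (use p0 in auto)
    thus ?thesis
      unfolding F_def tail weighted_dsum_def by (rule suminf_mult)
  qed
  have G_eq: "G p = rGamma (fst p + snd p - 2) * F p" if p: "p \<in> \<Omega>" for p
  proof -
    define V where "V = \<Omega> \<inter> {p. Re (snd p) > 1}"
    have hD: "holomorphic2_on (\<lambda>p. G p - rGamma (fst p + snd p - 2) * F p) \<Omega>"
      by (intro holomorphic2_on_diff holomorphic2_on_mult hF holomorphic2_on_subset[OF G(1)]
            holomorphic2_on_compose1[OF holomorphic_rGamma[of UNIV]] holomorphic2_on_add
            holomorphic2_on_const holomorphic2_on_fst holomorphic2_on_snd) auto
    have "open V" unfolding V_def
      by (intro open_Int open\<Omega> open_Collect_less continuous_intros)
    \<comment> \<open>The second coordinate is the midpoint of 1 and B, so it has real part above 1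
      and norm below B.\<close>
    moreover have "(of_real (B + 4), of_real ((B + 1) / 2)) \<in> V"
      using B by (simp add: V_def \<Omega>_def del: of_real_add of_real_divide)
    hence "V \<noteq> {}" by blast
    moreover have "V \<subseteq> \<Omega>" by (auto simp: V_def)
    moreover have "G q - rGamma (fst q + snd q - 2) * F q = 0" if "q \<in> V" for q
    proof -
      have "q \<in> shifted_region 0" "q \<in> \<Omega>" "Re (snd q) > 1"
        using that B by (auto simp: V_def \<Omega>_def shifted_region_def)
      thus ?thesis by (simp add: G(2) F_series polar_factor_def)
    qed
    ultimately have "G p - rGamma (fst p + snd p - 2) * F p = 0"
      by (rule holomorphic2_identity[OF hD open\<Omega> convex\<Omega> _ _ _ _ p])
    thus ?thesis by simp
  qed
  have nz: "polar_factor p \<noteq> 0" if "p \<in> \<Omega>" "snd p \<noteq> 1" for p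
    using that B abs_Re_le_cmod[of "snd p"] by (intro polar_factor_nonzero) (auto simp: \<Omega>_def)
  define D where "D = (\<Sum>n. real (Suc (Suc n)) powr (-2))"
  show ?thesis
  proof (rule that[OF hF, of "A * D * 2 powr (3 + B)"])
    fix p assume p: "p \<in> \<Omega>"
    have sL: "summable (\<lambda>n. L n p)"
      by (rule summable_comparison_test'[OF summable_mult[OF sm2, of A], of 0]) (rule L_le2[OF p])
    \<comment> \<open>The subtracted expression is exactly \<open>L 0 p\<close>, because
      \<open>zeta_term 0\<close> is identically 1.\<close>
    have "F p - (g (snd p) - (snd p - 1)) = (\<Sum>n. L (Suc n) p)"
      unfolding F_def suminf_split_head[OF sL] by (simp add: L_def zeta_term_def)
    moreover have "norm (\<Sum>n. L (Suc n) p) \<le>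
      (\<Sum>n. A * 2 powr (3 + B - Re (fst p)) * real (Suc (Suc n)) powr (-2))"
    proof (rule norm_suminf_le)
      show "summable (\<lambda>n. A * 2 powr (3 + B - Re (fst p)) * real (Suc (Suc n)) powr (-2))"
        using sm2 by (intro summable_mult) (subst summable_Suc_iff[of "\<lambda>n. real (Suc n) powr (-2)"])
      fix n
      \<comment> \<open>Two powers of n + 2 are set aside for summability. The remaining exponent is
        negative, so its base may be replaced by 2, which produces the exponential decay.\<close>
      have "1 + B - Re (fst p) = (3 + B - Re (fst p)) + (-2)" by simp
      hence "real (Suc (Suc n)) powr (1 + B - Re (fst p)) =
            real (Suc (Suc n)) powr (3 + B - Re (fst p)) * real (Suc (Suc n)) powr (-2)"
        by (simp only: powr_add)
      also have "\<dots> \<le> 2 powr (3 + B - Re (fst p)) * real (Suc (Suc n)) powr (-2)"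
        using p by (intro mult_right_mono powr_mono2') (auto simp: \<Omega>_def)
      finally show "norm (L (Suc n) p) \<le> A * 2 powr (3 + B - Re (fst p)) * real (Suc (Suc n)) powr (-2)"
        using L_le[OF p, of "Suc n"] A by (smt (verit) mult.assoc mult_left_mono)
    qed
    moreover have "(\<Sum>n. A * 2 powr (3 + B - Re (fst p)) * real (Suc (Suc n)) powr (-2)) =
        A * 2 powr (3 + B - Re (fst p)) * D"
      unfolding D_def using sm2
      by (intro suminf_mult) (subst summable_Suc_iff[of "\<lambda>n. real (Suc n) powr (-2)"])
    moreover have "2 powr (3 + B - Re (fst p)) = 2 powr (3 + B) * 2 powr (- Re (fst p))"
      by (simp add: powr_add[symmetric])
    ultimately show "norm (F p - (g (snd p) - (snd p - 1))) \<le> A * D * 2 powr (3 + B) * 2 powr (- Re (fst p))"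
      by (simp add: mult_ac)
    assume "snd p \<noteq> 1"
    with nz p have n: "polar_factor p \<noteq> 0" by blast
    thus "holomorphic2_at euler_double_zeta p" by (rule G(4))
    show "F p = (snd p - 1) * euler_double_zeta p"
      using n G(3)[OF n] G_eq[OF p] by (simp add: polar_factor_def)
  qed
qed

section \<open>Zeros for large real part of the first variable\<close>

text \<open>
  The entire function \<open>(s - 1) (\<zeta>(s) - 1)\<close>; its value \<open>1\<close> at \<open>s = 1\<close> is the residue of \<open>\<zeta>\<close>.
\<close>
definition reduced_zeta :: "complex \<Rightarrow> complex" where
  "reduced_zeta s = (SOME g. g holomorphic_on UNIV \<and> g 1 = 1 \<and>
      (\<forall>s. Re s > 1 \<longrightarrow> g s = (s - 1) * (\<Sum>n. zeta_term n s))) s - (s - 1)"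

lemma reduced_zeta_props:
  shows "reduced_zeta holomorphic_on A"
    and "reduced_zeta 1 = 1"
    and "riemann_zeta s = 1 \<longleftrightarrow> s \<noteq> 1 \<and> reduced_zeta s = 0"
    and "B > 1 \<Longrightarrow> \<exists>F C. holomorphic2_on F {p. Re (fst p) > B + 3 \<and> norm (snd p) < B} \<and>
      (\<forall>s1 s2. Re s1 > B + 3 \<and> norm s2 < B \<longrightarrow>
         norm (F (s1, s2) - reduced_zeta s2) \<le> C * 2 powr (- Re s1) \<and>
         (s2 \<noteq> 1 \<longrightarrow> F (s1, s2) = (s2 - 1) * euler_double_zeta (s1, s2) \<and>
           holomorphic2_at euler_double_zeta (s1, s2)))"
proof -
  define g where "g = (SOME g. g holomorphic_on UNIV \<and> g 1 = 1 \<and>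
      (\<forall>s. Re s > 1 \<longrightarrow> g s = (s - 1) * (\<Sum>n. zeta_term n s)))"
  have "\<exists>g. g holomorphic_on UNIV \<and> g 1 = 1 \<and>
      (\<forall>s. Re s > 1 \<longrightarrow> g s = (s - 1) * (\<Sum>n. zeta_term n s))"
    using zeta_continuation by metis
  from someI_ex[OF this] have g: "g holomorphic_on UNIV" "g 1 = 1"
    "\<And>s. Re s > 1 \<Longrightarrow> g s = (s - 1) * (\<Sum>n. zeta_term n s)"
    by (simp_all add: g_def)
  have eq: "reduced_zeta = (\<lambda>s. g s - (s - 1))"
    by (simp add: reduced_zeta_def[abs_def] g_def)
  show "reduced_zeta holomorphic_on A"
    unfolding eq by (intro holomorphic_intros holomorphic_on_subset[OF g(1)]) auto
  show "reduced_zeta 1 = 1" by (simp add: eq g)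
  \<comment> \<open>At s = 1 both sides are false, since division by zero gives
    \<open>riemann_zeta 1 = 0\<close>.\<close>
  show "riemann_zeta s = 1 \<longleftrightarrow> s \<noteq> 1 \<and> reduced_zeta s = 0"
    by (auto simp: riemann_zeta_eq[OF g] eq)
  show "\<exists>F C. holomorphic2_on F {p. Re (fst p) > B + 3 \<and> norm (snd p) < B} \<and>
      (\<forall>s1 s2. Re s1 > B + 3 \<and> norm s2 < B \<longrightarrow>
         norm (F (s1, s2) - reduced_zeta s2) \<le> C * 2 powr (- Re s1) \<and>
         (s2 \<noteq> 1 \<longrightarrow> F (s1, s2) = (s2 - 1) * euler_double_zeta (s1, s2) \<and>
           holomorphic2_at euler_double_zeta (s1, s2)))" if "B > 1"
  proof (rule euler_double_zeta_asymptotics[OF g(1,3) that])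
    fix F C
    let ?\<Omega> = "{p. Re (fst p) > B + 3 \<and> norm (snd p) < B}"
    assume F: "holomorphic2_on F ?\<Omega>"
      "\<And>p. p \<in> ?\<Omega> \<Longrightarrow> norm (F p - (g (snd p) - (snd p - 1))) \<le> C * 2 powr (- Re (fst p))"
      "\<And>p. p \<in> ?\<Omega> \<Longrightarrow> snd p \<noteq> 1 \<Longrightarrow> F p = (snd p - 1) * euler_double_zeta p"
      "\<And>p. p \<in> ?\<Omega> \<Longrightarrow> snd p \<noteq> 1 \<Longrightarrow> holomorphic2_at euler_double_zeta p"
    show ?thesis
      by (intro exI[of _ F] exI[of _ C] conjI allI impI F)
         (use F(2)[of "(_, _)"] F(3)[of "(_, _)"] in \<open>auto simp: eq\<close>)
  qed
qed

section \<open>Localisation of zeros near the solutions of zeta = 1\<close>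

lemma exists_exp_decay_below:
  assumes "\<eta> > 0"
  obtains R :: real where "\<And>x. x \<ge> R \<Longrightarrow> C * 2 powr (- x) < \<eta>"
proof -
  have "((\<lambda>x::real. C * 2 powr (- x)) \<longlongrightarrow> 0) at_top" by real_asymp
  from order_tendstoD(2)[OF this assms] show ?thesis
    using that by (auto simp: eventually_at_top_linorder)
qed

definition zeta_one_points :: "real \<Rightarrow> real \<Rightarrow> complex set" where
  "zeta_one_points B c = {w. norm w \<le> B \<and> c \<le> norm (w - 1) \<and> riemann_zeta w = 1}"

text \<open>Away from the solutions \<open>reduced_zeta\<close> is bounded below on a compact set,
  whereas at a zero of zeta_2 it is exponentially small in Re z. The threshold R depends only on B,
  c and \<delta>, so it serves for sequences and for whole connected sets.\<close>

lemma zero_set_near_zeta_one: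
  fixes B c \<delta> :: real
  assumes c: "c > 0" and \<delta>: "\<delta> > 0"
  shows "\<exists>R. \<forall>z w. (z, w) \<in> zero_set2 euler_double_zeta \<and> Re z > R \<and> norm w \<le> B \<and>
    c \<le> norm (w - 1) \<longrightarrow> (\<exists>\<rho>\<in>zeta_one_points B c. dist w \<rho> < \<delta>)"
proof -
  define K where "K = {w :: complex. norm w \<le> B \<and> c \<le> norm (w - 1)}"
  \<comment> \<open>Adding 2 ensures B' > 1 and puts the closed disc of radius B inside the open
    disc of the asymptotics.\<close>
  define B' where "B' = \<bar>B\<bar> + 2"
  have "B' > 1" by (simp add: B'_def)
  from reduced_zeta_props(4)[OF this] obtain F C where FC: "\<And>s1 s2. Re s1 > B' + 3 \<Longrightarrow> norm s2 < B' \<Longrightarrow>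
         norm (F (s1, s2) - reduced_zeta s2) \<le> C * 2 powr (- Re s1) \<and>
         (s2 \<noteq> 1 \<longrightarrow> F (s1, s2) = (s2 - 1) * euler_double_zeta (s1, s2))"
    by blast
  define Z where "Z = zeta_one_points B c"
  define K' where "K' = K - (\<Union>\<rho>\<in>Z. ball \<rho> \<delta>)"
  have one: "1 \<notin> K" using c by (simp add: K_def)
  have "K = cball 0 B \<inter> - ball 1 c"
    by (auto simp: K_def dist_norm norm_minus_commute)
  hence "compact K" by (simp add: compact_Int_closed closed_Compl)
  hence "compact K'" unfolding K'_def by (intro compact_diff) auto
  have "\<exists>\<eta>>0. \<forall>w\<in>K'. \<eta> \<le> norm (reduced_zeta w)"
  proof (cases "K' = {}")
    case True
    thus ?thesis by (auto intro: exI[of _ 1])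
  next
    case False
    have "continuous_on K' (\<lambda>w. norm (reduced_zeta w))"
      by (intro continuous_intros holomorphic_on_imp_continuous_on reduced_zeta_props(1))
    from continuous_attains_inf[OF \<open>compact K'\<close> False this]
    obtain w0 where w0: "w0 \<in> K'" "\<And>w. w \<in> K' \<Longrightarrow> norm (reduced_zeta w0) \<le> norm (reduced_zeta w)"
      by blast
    have "reduced_zeta w0 \<noteq> 0"
    proof
      assume "reduced_zeta w0 = 0"
      hence "w0 \<in> Z"
        using w0(1) one reduced_zeta_props(3) by (auto simp: Z_def zeta_one_points_def K_def K'_def)
      thus False using w0(1) \<delta> by (auto simp: K'_def)
    qed
    thus ?thesis using w0(2) by (intro exI[of _ "norm (reduced_zeta w0)"]) auto
  qed
  then obtain \<eta> where \<eta>: "\<eta> > 0" "\<And>w. w \<in> K' \<Longrightarrow> \<eta> \<le> norm (reduced_zeta w)" by blast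
  obtain R where R: "\<And>x. x \<ge> R \<Longrightarrow> C * 2 powr (- x) < \<eta>"
    using exists_exp_decay_below[OF \<eta>(1)] by metis
  have "\<exists>\<rho>\<in>Z. dist w \<rho> < \<delta>"
    if zw: "(z, w) \<in> zero_set2 euler_double_zeta" "Re z > max R (B' + 3)" "norm w \<le> B" "c \<le> norm (w - 1)"
    for z w
  proof -
    have "w \<in> K" using zw by (simp add: K_def)
    have "norm w < B'" using zw(3) unfolding B'_def by linarith
    moreover have "w \<noteq> 1" using \<open>w \<in> K\<close> one by blast
    moreover have "euler_double_zeta (z, w) = 0" using zw(1) by (simp add: zero_set2_def)
    ultimately have "norm (F (z, w) - reduced_zeta w) \<le> C * 2 powr (- Re z)" "F (z, w) = 0"
      using FC[of z w] zw(2) by auto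
    hence "norm (reduced_zeta w) \<le> C * 2 powr (- Re z)" by simp
    also have "\<dots> < \<eta>" using zw(2) by (intro R) auto
    finally have "w \<notin> K'" using \<eta>(2) by force
    thus ?thesis using \<open>w \<in> K\<close> by (auto simp: K'_def dist_commute)
  qed
  thus ?thesis unfolding Z_def by blast
qed

text \<open>The solutions are zeros of an entire function with value 1 at 1, so a compact disc
  contains only finitely many.\<close>

lemma finite_zeta_one:
  assumes "c > 0"
  shows "finite (zeta_one_points B c)"
proof -
  have "finite {w \<in> cball 0 B. reduced_zeta w = 0}"
  proof (cases "reduced_zeta constant_on UNIV")
    case True
    hence "reduced_zeta w = 1" for w
      using reduced_zeta_props(2) by (metis UNIV_I constant_on_def)
    thus ?thesis by simp
  next
    case False
    thus ?thesis
      by (intro holomorphic_compact_finite_zeros[OF reduced_zeta_props(1) open_UNIV connected_UNIV]) auto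
  qed
  thus ?thesis
    by (rule rev_finite_subset) (auto simp: zeta_one_points_def reduced_zeta_props(3))
qed

lemma finite_separation:
  fixes Z :: "'a::metric_space set"
  assumes "finite Z"
  obtains d where "d > 0" "\<And>x y. x \<in> Z \<Longrightarrow> y \<in> Z \<Longrightarrow> x \<noteq> y \<Longrightarrow> 2 * d \<le> dist x y"
proof -
  define D where "D = (\<lambda>(x, y). dist x y) ` {(x, y). x \<in> Z \<and> y \<in> Z \<and> x \<noteq> y}"
  have "finite {(x, y). x \<in> Z \<and> y \<in> Z \<and> x \<noteq> y}"
    by (rule finite_subset[of _ "Z \<times> Z"]) (use assms in auto)
  hence "finite D" unfolding D_def by (rule finite_imageI)
  \<comment> \<open>Inserting 1 makes the minimum meaningful when there are no two distinct
    points.\<close>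
  define d where "d = Min (insert 1 D) / 2"
  have "\<forall>x\<in>insert 1 D. x > 0" by (auto simp: D_def)
  hence "d > 0" using \<open>finite D\<close> by (auto simp: d_def)
  moreover have "2 * d \<le> dist x y" if "x \<in> Z" "y \<in> Z" "x \<noteq> y" for x y
  proof -
    have "dist x y \<in> D" using that by (force simp: D_def)
    thus ?thesis using \<open>finite D\<close> by (simp add: d_def)
  qed
  ultimately show ?thesis using that by blast
qed

text \<open>The sequence may oscillate between several solutions, so it is compared with a moving
  target: \<rho> m is a solution nearest to s2 m.\<close>

lemma double_zeta_zeros_approach:
  assumes zero: "\<And>m. (s1 m, s2 m) \<in> zero_set2 euler_double_zeta"
    and lim: "filterlim (\<lambda>m. Re (s1 m)) at_top sequentially"
    and K: "\<And>m. norm (s2 m) \<le> B" "c > 0" "\<And>m. c \<le> norm (s2 m - 1)"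
  shows "\<exists>\<rho>. (\<forall>m. riemann_zeta (\<rho> m) = 1) \<and> (\<lambda>m. s2 m - \<rho> m) \<longlonglongrightarrow> 0"
proof -
  define Z where "Z = zeta_one_points B c"
  have near: "\<forall>\<^sub>F m in sequentially. \<exists>\<rho>\<in>Z. dist (s2 m) \<rho> < \<delta>" if \<delta>: "\<delta> > 0" for \<delta>
  proof -
    obtain R where R: "\<forall>z w. (z, w) \<in> zero_set2 euler_double_zeta \<and> Re z > R \<and> norm w \<le> B \<and>
        c \<le> norm (w - 1) \<longrightarrow> (\<exists>\<rho>\<in>Z. dist w \<rho> < \<delta>)"
      using zero_set_near_zeta_one[OF K(2) \<delta>] unfolding Z_def by blast
    have "\<forall>\<^sub>F m in sequentially. Re (s1 m) > R"
      using lim by (simp add: filterlim_at_top_dense)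
    thus ?thesis
      by eventually_elim (use R zero K in blast)
  qed
  \<comment> \<open>Solutions exist because some member of the sequence is already within distance 1
    of one.\<close>
  have "Z \<noteq> {}"
    using eventually_happens'[OF _ near[of 1]] by auto
  moreover have "closed Z"
    using finite_zeta_one[OF K(2)] by (simp add: Z_def finite_imp_closed)
  ultimately have "\<forall>m. \<exists>\<rho>\<in>Z. \<forall>\<rho>'\<in>Z. dist (s2 m) \<rho> \<le> dist (s2 m) \<rho>'"
    using distance_attains_inf by metis
  then obtain \<rho> where \<rho>: "\<And>m. \<rho> m \<in> Z" "\<And>m \<rho>'. \<rho>' \<in> Z \<Longrightarrow> dist (s2 m) (\<rho> m) \<le> dist (s2 m) \<rho>'"
    by metis
  have "(\<lambda>m. s2 m - \<rho> m) \<longlonglongrightarrow> 0"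
  proof (rule tendstoI)
    fix \<delta> :: real assume "\<delta> > 0"
    from near[OF this] show "\<forall>\<^sub>F m in sequentially. dist (s2 m - \<rho> m) 0 < \<delta>"
    proof eventually_elim
      case (elim m)
      then obtain \<rho>' where "\<rho>' \<in> Z" "dist (s2 m) \<rho>' < \<delta>" by blast
      with \<rho>(2)[of \<rho>' m] show ?case by (simp add: dist_norm)
    qed
  qed
  thus ?thesis using \<rho>(1) by (auto simp: Z_def zeta_one_points_def)
qed

text \<open>The s2-projection of a connected piece of the zero-set is connected and covered by
  disjoint small balls around finitely many solutions, so a single ball contains it.\<close>

lemma double_zeta_zeros_converge:
  assumes c: "c > 0"
    and conn: "\<forall>R. \<exists>C. connected C \<and>
      C \<subseteq> zero_set2 euler_double_zeta \<inter>
        {(z, w). Re z > R \<and> norm w \<le> B \<and> c \<le> norm (w - 1)} \<and>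
      (\<forall>\<^sub>F m in sequentially. (s1 m, s2 m) \<in> C)"
  shows "\<exists>\<rho>. riemann_zeta \<rho> = 1 \<and> s2 \<longlonglongrightarrow> \<rho>"
proof -
  define Z where "Z = zeta_one_points B c"
  have "finite Z" using finite_zeta_one[OF c] by (simp add: Z_def)
  then obtain d where d: "d > 0" "\<And>x y. x \<in> Z \<Longrightarrow> y \<in> Z \<Longrightarrow> x \<noteq> y \<Longrightarrow> 2 * d \<le> dist x y"
    using finite_separation by metis
  \<comment> \<open>Centres are at least 2 d apart, so balls of radius \<delta> \<le> d are
    disjoint.\<close>
  have near: "\<exists>\<rho>\<in>Z. \<forall>\<^sub>F m in sequentially. dist (s2 m) \<rho> < \<delta>" if \<delta>: "\<delta> > 0" "\<delta> \<le> d" for \<delta>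
  proof -
    obtain R where R: "\<forall>z w. (z, w) \<in> zero_set2 euler_double_zeta \<and> Re z > R \<and> norm w \<le> B \<and>
        c \<le> norm (w - 1) \<longrightarrow> (\<exists>\<rho>\<in>Z. dist w \<rho> < \<delta>)"
      using zero_set_near_zeta_one[OF c \<delta>(1)] unfolding Z_def by blast
    obtain C where C: "connected C"
      "C \<subseteq> zero_set2 euler_double_zeta \<inter> {(z, w). Re z > R \<and> norm w \<le> B \<and> c \<le> norm (w - 1)}"
      "\<forall>\<^sub>F m in sequentially. (s1 m, s2 m) \<in> C"
      using conn by blast
    have cover: "\<exists>\<rho>\<in>Z. dist w \<rho> < \<delta>" if "w \<in> snd ` C" for w
      using that C(2) R by fastforce
    have "connected (snd ` C)"
      by (intro connected_continuous_image continuous_intros C)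
    obtain m0 where "(s1 m0, s2 m0) \<in> C"
      using eventually_happens'[OF _ C(3)] by auto
    hence w0: "s2 m0 \<in> snd ` C" by force
    then obtain \<rho> where \<rho>: "\<rho> \<in> Z" "dist (s2 m0) \<rho> < \<delta>" using cover by blast
    let ?U = "ball \<rho> \<delta>" and ?V = "\<Union>\<rho>'\<in>Z - {\<rho>}. ball \<rho>' \<delta>"
    have "?U \<inter> ?V = {}"
    proof -
      have "ball \<rho> \<delta> \<inter> ball \<rho>' \<delta> = {}" if "\<rho>' \<in> Z - {\<rho>}" for \<rho>'
      proof (rule disjoint_ballI)
        show "dist \<rho> \<rho>' \<ge> \<delta> + \<delta>" using d(2)[of \<rho> \<rho>'] \<rho>(1) that \<delta>(2) by auto
      qed
      thus ?thesis by blast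
    qed
    moreover have "snd ` C \<subseteq> ?U \<union> ?V" using cover by (fastforce simp: dist_commute)
    ultimately have "?U \<inter> snd ` C = {} \<or> ?V \<inter> snd ` C = {}"
      by (intro connectedD[OF \<open>connected (snd ` C)\<close>]) auto
    moreover have "s2 m0 \<in> ?U \<inter> snd ` C" using w0 \<rho> by (simp add: dist_commute)
    ultimately have "snd ` C \<subseteq> ?U" using \<open>snd ` C \<subseteq> ?U \<union> ?V\<close> by blast
    hence "\<forall>\<^sub>F m in sequentially. dist (s2 m) \<rho> < \<delta>"
      using C(3) by (auto elim!: eventually_mono simp: dist_commute)
    thus ?thesis using \<rho>(1) by blast
  qed
  \<comment> \<open>The solution is fixed at scale d; every smaller scale selects one at distance
    less than 2 d from it, hence the same one.\<close>
  obtain \<rho> where \<rho>: "\<rho> \<in> Z" "\<forall>\<^sub>F m in sequentially. dist (s2 m) \<rho> < d"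
    using near[of d] d(1) by auto
  have "s2 \<longlonglongrightarrow> \<rho>"
  proof (rule tendstoI)
    fix \<delta> :: real assume "\<delta> > 0"
    then obtain \<rho>' where \<rho>': "\<rho>' \<in> Z" "\<forall>\<^sub>F m in sequentially. dist (s2 m) \<rho>' < min \<delta> d"
      using near[of "min \<delta> d"] d(1) by auto
    obtain m where m: "dist (s2 m) \<rho> < d" "dist (s2 m) \<rho>' < min \<delta> d"
      using eventually_happens'[OF _ eventually_conj[OF \<rho>(2) \<rho>'(2)]] by auto
    have "dist \<rho> \<rho>' < 2 * d" using m dist_triangle3[of \<rho> \<rho>' "s2 m"] by auto
    hence "\<rho>' = \<rho>" using d(2)[OF \<rho>(1) \<rho>'(1)] by fastforce
    thus "\<forall>\<^sub>F m in sequentially. dist (s2 m) \<rho> < \<delta>"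
      using \<rho>'(2) by (auto elim: eventually_mono)
  qed
  thus ?thesis using \<rho>(1) by (auto simp: Z_def zeta_one_points_def)
qed

text \<open>Without zeros near \<rho>, the functions \<open>F (x n, w)\<close> would be zero-free on
  a disc and converge locally uniformly to a non-constant limit that vanishes at \<rho>, against
  Hurwitz's theorem.\<close>

lemma double_zeta_zero_near_zeta_one:
  assumes \<rho>: "riemann_zeta \<rho> = 1" and \<epsilon>: "\<epsilon> > 0"
  shows "\<exists>s1 s2. (s1, s2) \<in> zero_set2 euler_double_zeta \<and> norm (s2 - \<rho>) < \<epsilon>"
proof (rule ccontr)
  assume none: "\<not> ?thesis"
  have \<rho>1: "\<rho> \<noteq> 1" "reduced_zeta \<rho> = 0" using \<rho> reduced_zeta_props(3) by auto
  \<comment> \<open>The disc must avoid 1, where F is not tied to zeta_2, and stay within \<epsilon>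
    of \<rho>.\<close>
  define r where "r = min \<epsilon> (dist \<rho> 1)"
  have r: "r > 0" "r \<le> \<epsilon>" "r \<le> dist \<rho> 1" using \<epsilon> \<rho>1 by (auto simp: r_def)
  define S where "S = ball \<rho> r"
  have S1: "w \<noteq> 1" "norm (w - \<rho>) < \<epsilon>" if "w \<in> S" for w
    using that r by (auto simp: S_def dist_norm norm_minus_commute)
  define B where "B = norm \<rho> + r + 1"
  have B: "B > 1" using r(1) by (simp add: B_def add_nonneg_pos)
  have SB: "norm w < B" if "w \<in> S" for w
    using that norm_triangle_ineq2[of w \<rho>] by (simp add: S_def B_def dist_norm norm_minus_commute)
  from reduced_zeta_props(4)[OF B] obtain F C where
    hF: "holomorphic2_on F {p. Re (fst p) > B + 3 \<and> norm (snd p) < B}" and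
    FC: "\<And>s1 s2. Re s1 > B + 3 \<Longrightarrow> norm s2 < B \<Longrightarrow>
         norm (F (s1, s2) - reduced_zeta s2) \<le> C * 2 powr (- Re s1) \<and>
         (s2 \<noteq> 1 \<longrightarrow> F (s1, s2) = (s2 - 1) * euler_double_zeta (s1, s2) \<and>
           holomorphic2_at euler_double_zeta (s1, s2))"
    by blast
  define x where "x = (\<lambda>n::nat. complex_of_real (B + 4 + real n))"
  have x: "Re (x n) > B + 3" for n by (simp add: x_def)
  have "reduced_zeta \<rho> \<noteq> 0"
  proof (rule Hurwitz_no_zeros[of S "\<lambda>n w. F (x n, w)" reduced_zeta])
    show "open S" "connected S" by (simp_all add: S_def)
    show "(\<lambda>w. F (x n, w)) holomorphic_on S" for n
      by (rule holomorphic2_on_imp_holomorphic_on[OF hF])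
         (auto intro!: holomorphic_intros simp: x SB S_def[symmetric] \<open>open S\<close>)
    show "reduced_zeta holomorphic_on S" by (rule reduced_zeta_props)
    show "uniform_limit K (\<lambda>n w. F (x n, w)) reduced_zeta sequentially" if "compact K" "K \<subseteq> S" for K
    proof (rule uniform_limitI)
      fix e :: real assume "e > 0"
      then obtain R where R: "\<And>y. y \<ge> R \<Longrightarrow> C * 2 powr (- y) < e"
        using exists_exp_decay_below by metis
      have "filterlim (\<lambda>n. Re (x n)) at_top sequentially"
        unfolding x_def Re_complex_of_real by real_asymp
      hence "\<forall>\<^sub>F n in sequentially. Re (x n) \<ge> R" by (simp add: filterlim_at_top)
      thus "\<forall>\<^sub>F n in sequentially. \<forall>w\<in>K. dist (F (x n, w)) (reduced_zeta w) < e"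
      proof eventually_elim
        case (elim n)
        show ?case
        proof
          fix w assume "w \<in> K"
          hence "norm w < B" using SB that by blast
          thus "dist (F (x n, w)) (reduced_zeta w) < e"
            using FC[OF x, of w n] R[OF elim] unfolding dist_norm by linarith
        qed
      qed
    qed
    show "\<not> reduced_zeta constant_on S"
    proof
      assume "reduced_zeta constant_on S"
      moreover have "\<rho> \<in> S" using r(1) by (simp add: S_def)
      ultimately have z: "reduced_zeta w = 0" if "w \<in> S" for w
        using that \<rho>1(2) unfolding constant_on_def by metis
      \<comment> \<open>A constant limit would be 0 on S, and continuation to all of C would
        contradict the residue value 1.\<close>
      have "reduced_zeta 1 = 0"
        by (rule analytic_continuation_open[of S UNIV reduced_zeta "\<lambda>_. 0"])
           (use z reduced_zeta_props(1) \<open>\<rho> \<in> S\<close> in \<open>auto simp: S_def\<close>)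
      thus False using reduced_zeta_props(2) by simp
    qed
    show "F (x n, w) \<noteq> 0" if w: "w \<in> S" for n w
    proof
      assume "F (x n, w) = 0"
      moreover have "F (x n, w) = (w - 1) * euler_double_zeta (x n, w)"
        "holomorphic2_at euler_double_zeta (x n, w)"
        using FC[OF x SB[OF w], of n] S1[OF w] by auto
      ultimately have "(x n, w) \<in> zero_set2 euler_double_zeta"
        using S1[OF w] by (simp add: zero_set2_def)
      thus False using none S1[OF w] by blast
    qed
    show "\<rho> \<in> S" using r(1) by (simp add: S_def)
  qed
  thus False using \<rho>1 by blast
qed

text \<open>The connected sets C express that the sequence eventually stays on one branch of the
  zero-divisor as Re s1 grows; this singles out one limit, while for arbitrary sequences of zeros
  the approach is to the solution set.\<close>

theorem proposition1:
  shows
    "(\<forall>(s1 :: nat \<Rightarrow> complex) (s2 :: nat \<Rightarrow> complex) B c.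
        (\<forall>m. (s1 m, s2 m) \<in> zero_set2 euler_double_zeta) \<and>
        filterlim (\<lambda>m. Re (s1 m)) at_top sequentially \<and>
        (\<forall>m. cmod (s2 m) \<le> B) \<and>
        c > 0 \<and> (\<forall>m. c \<le> cmod (s2 m - 1)) \<longrightarrow>
          (\<exists>\<rho> :: nat \<Rightarrow> complex. (\<forall>m. riemann_zeta (\<rho> m) = 1) \<and> (\<lambda>m. s2 m - \<rho> m) \<longlonglongrightarrow> 0) \<and>
          ((\<forall>R. \<exists>C. connected C \<and>
                 C \<subseteq> zero_set2 euler_double_zeta \<inter>
                       {(z, w). Re z > R \<and> cmod w \<le> B \<and> c \<le> cmod (w - 1)} \<and>
                 (\<forall>\<^sub>F m in sequentially. (s1 m, s2 m) \<in> C)) \<longrightarrow>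
             (\<exists>\<rho>. riemann_zeta \<rho> = 1 \<and> s2 \<longlonglongrightarrow> \<rho>)))
     \<and>
     (\<forall>\<rho> \<epsilon>. riemann_zeta \<rho> = 1 \<and> (\<epsilon> :: real) > 0 \<longrightarrow>
        (\<exists>s1 s2. (s1, s2) \<in> zero_set2 euler_double_zeta \<and> cmod (s2 - \<rho>) < \<epsilon>))"
  apply (intro conjI allI impI; elim conjE)
    apply (rule double_zeta_zeros_approach; (erule spec | assumption))
   apply (rule double_zeta_zeros_converge; assumption)
  apply (rule double_zeta_zero_near_zeta_one; assumption)
  done

end
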